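(* Let $K$ be an algebraically closed field with uncountably many elements, let $n\ge1$, and let $x\in\mathbb{A}^n_{K,\infty}$ be a (not necessarily closed) point fixed by the action of $G=\operatorname{Sym}(\infty)$, i.e. a $G$-invariant prime ideal of $K[x_{ij}:i\in\mathbb{N},j\in\{1,\dots,n\}]$. Then there are an algebraically closed field extension $K\subset L$ and a point $y\in\mathbb{A}^n_L$ such that $x=\pi(y_\infty)$, where $\pi:\mathbb{A}^n_{L,\infty}\to\mathbb{A}^n_{K,\infty}$ is the natural projection.
   Context: For a field $F$, $\mathbb{A}^n_F=\operatorname{Spec}(F[x_1,\dots,x_n])$ and $\mathbb{A}^n_{F,\infty}=\operatorname{Spec}(F[x_{ij}:i\in\mathbb{N},j\in\{1,\dots,n\}])$. The group $G=\operatorname{Sym}(\infty)=\bigcup_k\operatorname{Sym}(k)$ acts by $F$-algebra automorphisms via $\sigma(x_{ij})=x_{\sigma(i)j}$, hence on $\mathbb{A}^n_{F,\infty}$. The natural projection $\pi:\mathbb{A}^n_{L,\infty}\to\mathbb{A}^n_{K,\infty}$ is induced by the inclusion $K[x_{ij}]\subset L[x_{ij}]$, i.e. it sends a prime ideal $\mathfrak{q}$ to $\mathfrak{q}\cap K[x_{ij}]$. For a point $y\in\mathbb{A}^n_L$ corresponding to a prime ideal $\mathfrak{p}\subset L[x_1,\dots,x_n]$, $y_\infty\in\mathbb{A}^n_{L,\infty}$ denotes the point given by the ideal of $L[x_{ij}:i\in\mathbb{N},j\in\{1,\dots,n\}]$ generated by all $f(x_{i1},\dots,x_{in})$ with $f\in\mathfrak{p}$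 and $i\in\mathbb{N}$; for $L$ algebraically closed this is a $G$-invariant prime ideal. *)

theory Defs
  imports "HOL-Algebra.Algebra" "HOL-Algebra.Algebraic_Closure_Type" "HOL-Library.Countable_Set"
begin

text \<open>
  The polynomial ring \<open>R[x\<^sub>v : v \<in> I]\<close>. As in \<^theory>\<open>HOL-Algebra.Indexed_Polynomials\<close>, a
  monomial is a finite multiset of variables and a polynomial maps each monomial to its
  coefficient. That theory supplies the underlying set, constants and addition, but no
  multiplication of two polynomials.
\<close>

definition mpoly_mult ::
    "('a, 'm) ring_scheme \<Rightarrow> ('v multiset \<Rightarrow> 'a) \<Rightarrow> ('v multiset \<Rightarrow> 'a) \<Rightarrow> 'v multiset \<Rightarrow> 'a" where
  "mpoly_mult R f g = (\<lambda>m. finsum R (\<lambda>(a, b). f a \<otimes>\<^bsub>R\<^esub> g b) {(a, b). a + b = m})"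

definition mpoly_ring :: "('a, 'm) ring_scheme \<Rightarrow> 'v set \<Rightarrow> ('v multiset \<Rightarrow> 'a) ring" where
  "mpoly_ring R I =
    \<lparr> carrier = ring.indexed_pset R I (carrier R),
      monoid.mult = mpoly_mult R,
      one = ring.indexed_const R \<one>\<^bsub>R\<^esub>,
      ring.zero = ring.indexed_const R \<zero>\<^bsub>R\<^esub>,
      add = ring.indexed_padd R \<rparr>"

text \<open>
  The \<open>R\<close>-algebra homomorphism that sends the variable with index \<open>v\<close> to the one with index
  \<open>\<phi> v\<close>: the coefficient of a monomial in the
  result is the sum of the coefficients of all monomials that are mapped to it.
\<close>

definition mpoly_rename ::
    "('a, 'm) ring_scheme \<Rightarrow> ('v \<Rightarrow> 'w) \<Rightarrow> ('v multiset \<Rightarrow> 'a) \<Rightarrow> 'w multiset \<Rightarrow> 'a" where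
  "mpoly_rename R \<phi> f =
    (\<lambda>m'. \<Oplus>\<^bsub>R\<^esub>m \<in> {m. f m \<noteq> \<zero>\<^bsub>R\<^esub> \<and> image_mset \<phi> m = m'}. f m)"

text \<open>
  Coordinate rings of \<open>\<bbbA>\<^sup>n\<close> and of \<open>\<bbbA>\<^sup>n\<^sub>\<infinity>\<close>; the pair \<open>(i, j)\<close> is the index of the variable \<open>x\<^sub>i\<^sub>j\<close>.
  Points of these affine schemes are prime ideals.
\<close>

definition aff_ring :: "('a, 'm) ring_scheme \<Rightarrow> nat \<Rightarrow> (nat multiset \<Rightarrow> 'a) ring" where
  "aff_ring R n = mpoly_ring R {1..n}"

definition aff_inf_ring ::
    "('a, 'm) ring_scheme \<Rightarrow> nat \<Rightarrow> ((nat \<times> nat) multiset \<Rightarrow> 'a) ring" where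
  "aff_inf_ring R n = mpoly_ring R (UNIV \<times> {1..n})"

definition Sym_inf :: "(nat \<Rightarrow> nat) set" where
  "Sym_inf = (\<Union>k. {\<sigma>. \<sigma> permutes {..<k}})"

definition sym_act ::
    "('a, 'm) ring_scheme \<Rightarrow> (nat \<Rightarrow> nat) \<Rightarrow>
      ((nat \<times> nat) multiset \<Rightarrow> 'a) \<Rightarrow> (nat \<times> nat) multiset \<Rightarrow> 'a" where
  "sym_act R \<sigma> = mpoly_rename R (\<lambda>(i, j). (\<sigma> i, j))"

text \<open>The ideal defining \<open>y\<^sub>\<infinity>\<close>, where \<open>f(x\<^sub>i\<^sub>1, \<dots>, x\<^sub>i\<^sub>n)\<close> renames \<open>x\<^sub>j\<close> to \<open>x\<^sub>i\<^sub>j\<close>.\<close>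

definition inf_point ::
    "('a, 'm) ring_scheme \<Rightarrow> nat \<Rightarrow> (nat multiset \<Rightarrow> 'a) set \<Rightarrow>
      ((nat \<times> nat) multiset \<Rightarrow> 'a) set" where
  "inf_point R n p =
    Idl\<^bsub>aff_inf_ring R n\<^esub> {mpoly_rename R (\<lambda>j. (i, j)) f | i f. f \<in> p}"

text \<open>
  The projection on spectra for a field extension given by an embedding \<open>h\<close> of \<open>K\<close>: the
  embedding acts on polynomials coefficientwise, so this is \<open>q \<inter> K[x\<^sub>i\<^sub>j]\<close> when \<open>h\<close> is an inclusion.
\<close>

definition proj_point ::
    "('a, 'm) ring_scheme \<Rightarrow> nat \<Rightarrow> ('a \<Rightarrow> 'b) \<Rightarrow>
      ((nat \<times> nat) multiset \<Rightarrow> 'b) set \<Rightarrow> ((nat \<times> nat) multiset \<Rightarrow> 'a) set" where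
  "proj_point K n h q = {f \<in> carrier (aff_inf_ring K n). h \<circ> f \<in> q}"

text \<open>
  An algebraically closed extension field of \<open>K :: 'k\<close> is rendered as a ring record over
  \<open>nat \<Rightarrow> 'k\<close> with an embedding of \<open>K\<close>, since HOL cannot quantify existentially over types.
  The type only bounds the cardinality of \<open>L\<close> and has no algebraic meaning. The bound is
  harmless: a prime ideal of \<open>L[x\<^sub>1, \<dots>, x\<^sub>n]\<close> is already defined over an algebraically closed
  subfield of finite transcendence degree over \<open>K\<close>, which has the cardinality of \<open>K\<close>.
\<close>

end

theory Submission
  imports Defs
begin

text \<open>
  Let \<open>L\<close> be an algebraic closure of the residue field of \<open>x\<close> and \<open>\<xi>\<^sub>i \<in> L\<^sup>n\<close> the image of
  \<open>(x\<^sub>i\<^sub>1, \<dots>, x\<^sub>i\<^sub>n)\<close>, so that \<open>f \<in> x\<close> iff \<open>f(\<xi>\<^sub>0, \<xi>\<^sub>1, \<dots>) = 0\<close>. For a nonprincipal ultrafilter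
  \<open>U\<close> on the block indices, let \<open>y\<close> be the prime ideal of all \<open>g\<close> with \<open>g(\<xi>\<^sub>i) = 0\<close> for \<open>U\<close>-almost
  all \<open>i\<close>. Because the \<open>\<xi>\<^sub>i\<close> already have coordinates in \<open>L\<close>, the ideal \<open>y\<^sub>\<infinity>\<close> consists exactly of
  those \<open>F\<close> for which \<open>F(\<xi>\<^bsub>b 0\<^esub>, \<dots>, \<xi>\<^bsub>b (m - 1)\<^esub>) = 0\<close> holds when the indices
  \<open>b (m - 1), \<dots>, b 0\<close> are chosen one after the other, each \<open>U\<close>-almost everywhere: writing
  \<open>F = \<Sum>\<^sub>t E\<^sub>t(x\<^sub>0, \<dots>, x\<^bsub>m - 1\<^esub>) G\<^sub>t(x\<^sub>m)\<close>, the relations \<open>\<Sum>\<^sub>t E\<^sub>t G\<^sub>t(\<xi>\<^sub>i)\<close> lying in \<open>y\<^sub>\<infinity>\<close>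
  eliminate the \<open>E\<^sub>t\<close> one by one. If \<open>F\<close> has coefficients in \<open>K\<close>, then by invariance of \<open>x\<close> its
  vanishing at \<open>\<xi> \<circ> b\<close> does not depend on the injective choice \<open>b\<close>, and \<open>F \<in> y\<^sub>\<infinity>\<close> iff \<open>F \<in> x\<close>.
\<close>

section \<open>Polynomial rings\<close>

lemma mpoly_ring_simps:
  "carrier (mpoly_ring R I) = ring.indexed_pset R I (carrier R)"
  "monoid.mult (mpoly_ring R I) = mpoly_mult R"
  "one (mpoly_ring R I) = ring.indexed_const R \<one>\<^bsub>R\<^esub>"
  "ring.zero (mpoly_ring R I) = ring.indexed_const R \<zero>\<^bsub>R\<^esub>"
  "add (mpoly_ring R I) = ring.indexed_padd R"
  by (simp_all add: mpoly_ring_def)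

text \<open>A splitting of \<open>add_mset v m\<close> comes from one of \<open>m\<close> by adding
  \<open>v\<close> to one of the two parts. Finiteness makes \<open>mpoly_mult\<close> a genuine
  convolution, as \<open>finsum\<close> over an infinite set is zero by default.\<close>

lemma finite_sum_pairs: "finite {(a, b). a + b = (m :: 'v multiset)}"
proof (induction m)
  case empty
  have "{(a, b). a + b = ({#} :: 'v multiset)} = {({#}, {#})}" by auto
  then show ?case by simp
next
  case (add v m)
  let ?S = "{(a, b). a + b = m}"
  have "{(a, b). a + b = add_mset v m}
      \<subseteq> (\<lambda>(a, b). (add_mset v a, b)) ` ?S \<union> (\<lambda>(a, b). (a, add_mset v b)) ` ?S"
  proof clarify
    fix a b assume ab: "a + b = add_mset v m"
      and n: "(a, b) \<notin> (\<lambda>(a, b). (a, add_mset v b)) ` ?S"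
    have "v \<in># a \<or> v \<in># b"
      using ab by (metis union_iff union_single_eq_member)
    then consider c where "a = add_mset v c" | c where "b = add_mset v c"
      by (meson multi_member_split)
    then show "(a, b) \<in> (\<lambda>(a, b). (add_mset v a, b)) ` ?S"
    proof cases
      case 1
      then have "(c, b) \<in> ?S" using ab by simp
      then show ?thesis using 1 by force
    next
      case 2
      then have "(a, c) \<in> ?S" using ab by simp
      then show ?thesis using 2 n by force
    qed
  qed
  then show ?case using add by (meson finite_UnI finite_imageI finite_subset)
qed

context cring
begin

lemma carrier_coeff_psetD: "P \<in> indexed_pset I (carrier R) \<Longrightarrow> carrier_coeff P"
  by (rule indexed_pset_in_carrier) auto

lemma indexed_pset_mono: "I \<subseteq> J \<Longrightarrow> P \<in> indexed_pset I K \<Longrightarrow> P \<in> indexed_pset J K"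
  by (erule indexed_pset.induct) (auto intro: indexed_pset.intros)

text \<open>\<open>mpoly_eval\<close> and \<open>mpoly_rename\<close> sum over the support or a part
  of it, so this makes them honest finite sums.\<close>

lemma finite_support:
  assumes "P \<in> indexed_pset I (carrier R)" shows "finite {m. P m \<noteq> \<zero>}"
  using assms
proof induction
  case (indexed_const k)
  have "{m. indexed_const k m \<noteq> \<zero>} \<subseteq> {{#}}" by (auto simp: indexed_const_def)
  then show ?case by (rule finite_subset) simp
next
  case (indexed_padd P Q)
  have "{m. indexed_padd P Q m \<noteq> \<zero>} \<subseteq> {m. P m \<noteq> \<zero>} \<union> {m. Q m \<noteq> \<zero>}"
    by (auto simp: indexed_padd_def)
  then show ?case using indexed_padd.IH by (meson finite_UnI finite_subset)
next
  case (indexed_pmult P i)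
  have "{m. indexed_pmult P i m \<noteq> \<zero>} \<subseteq> add_mset i ` {m. P m \<noteq> \<zero>}"
    by (auto simp: indexed_pmult_def image_iff intro!: exI[of _ "_ - {#i#}"] split: if_splits)
  then show ?case using indexed_pmult.IH by (meson finite_imageI finite_subset)
qed

lemma mpoly_mult_coeff [intro]:
  "carrier_coeff f \<Longrightarrow> carrier_coeff g \<Longrightarrow> carrier_coeff (mpoly_mult R f g)"
  unfolding carrier_coeff_def mpoly_mult_def by (auto intro!: finsum_closed)

lemma mpoly_mult_comm:
  fixes f :: "'v multiset \<Rightarrow> 'a"
  assumes "carrier_coeff f" "carrier_coeff g"
  shows "mpoly_mult R f g = mpoly_mult R g f"
proof
  fix m :: "'v multiset"
  let ?S = "{(a, b). a + b = m}"
  have S: "?S = prod.swap ` ?S" by (auto simp: union_commute image_iff)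
  have "mpoly_mult R f g m = finsum R (\<lambda>(a, b). f a \<otimes> g b) (prod.swap ` ?S)"
    unfolding mpoly_mult_def using S by simp
  also have "\<dots> = finsum R (\<lambda>p. (\<lambda>(a, b). f a \<otimes> g b) (prod.swap p)) ?S"
    using assms by (intro finsum_reindex) (auto simp: carrier_coeff_def)
  also have "\<dots> = mpoly_mult R g f m"
    unfolding mpoly_mult_def using assms
    by (intro finsum_cong') (auto simp: carrier_coeff_def m_comm)
  finally show "mpoly_mult R f g m = mpoly_mult R g f m" .
qed

lemma mpoly_mult_padd:
  fixes f :: "'v multiset \<Rightarrow> 'a"
  assumes "carrier_coeff f" "carrier_coeff g" "carrier_coeff h"
  shows "mpoly_mult R f (indexed_padd g h) = indexed_padd (mpoly_mult R f g) (mpoly_mult R f h)"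
proof
  fix m :: "'v multiset"
  have "mpoly_mult R f (indexed_padd g h) m
      = finsum R (\<lambda>p. (\<lambda>(a, b). f a \<otimes> g b) p \<oplus> (\<lambda>(a, b). f a \<otimes> h b) p) {(a, b). a + b = m}"
    unfolding mpoly_mult_def indexed_padd_def using assms
    by (intro finsum_cong') (auto simp: carrier_coeff_def r_distr)
  also have "\<dots> = indexed_padd (mpoly_mult R f g) (mpoly_mult R f h) m"
    unfolding mpoly_mult_def indexed_padd_def using assms
    by (intro finsum_addf) (auto simp: carrier_coeff_def)
  finally show "mpoly_mult R f (indexed_padd g h) m = \<dots>" .
qed

lemma mpoly_mult_const:
  fixes f :: "'v multiset \<Rightarrow> 'a"
  assumes "carrier_coeff f" "c \<in> carrier R"
  shows "mpoly_mult R f (indexed_const c) = (\<lambda>m. f m \<otimes> c)"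
proof
  fix m :: "'v multiset"
  have "mpoly_mult R f (indexed_const c) m = finsum R (\<lambda>(a, b). f a \<otimes> c) {(m, {#} :: 'v multiset)}"
    unfolding mpoly_mult_def
    by (rule add.finprod_mono_neutral_cong)
      (use assms in \<open>auto simp: finite_sum_pairs carrier_coeff_def indexed_const_def
        split: if_splits\<close>)
  then show "mpoly_mult R f (indexed_const c) m = f m \<otimes> c"
    using assms by (simp add: carrier_coeff_def)
qed

text \<open>If \<open>v\<close> occurs in \<open>m\<close>, pairs whose second part lacks
  \<open>v\<close> contribute zero and the others correspond to the splittings of
  \<open>m - {#v#}\<close>. With \<open>mpoly_mult_const\<close> and \<open>mpoly_mult_padd\<close>
  this describes products by recursion on the right factor, the basis of later inductions over
  \<open>indexed_pset\<close>.\<close>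

lemma mpoly_mult_pmult:
  fixes f :: "'v multiset \<Rightarrow> 'a"
  assumes "carrier_coeff f" "carrier_coeff g"
  shows "mpoly_mult R f (indexed_pmult g v) = indexed_pmult (mpoly_mult R f g) v"
proof
  fix m :: "'v multiset"
  show "mpoly_mult R f (indexed_pmult g v) m = indexed_pmult (mpoly_mult R f g) v m"
  proof (cases "v \<in># m")
    case False
    have "mpoly_mult R f (indexed_pmult g v) m = finsum R (\<lambda>_. \<zero>) {(a, b). a + b = m}"
      unfolding mpoly_mult_def using assms False
      by (intro finsum_cong') (auto simp: carrier_coeff_def indexed_pmult_def)
    then show ?thesis using False by (simp add: indexed_pmult_def)
  next
    case True
    let ?S = "{(a, b). a + b = m - {#v#}}" and ?s = "\<lambda>(a, b). (a, add_mset v b)"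
    have "mpoly_mult R f (indexed_pmult g v) m
        = finsum R (\<lambda>(a, b). f a \<otimes> indexed_pmult g v b) (?s ` ?S)"
      unfolding mpoly_mult_def
    proof (intro add.finprod_mono_neutral_cong finite_imageI finite_sum_pairs)
      fix p assume p: "p \<in> {(a, b). a + b = m} - ?s ` ?S"
      obtain a b where ab: "p = (a, b)" "a + b = m" using p by auto
      have "v \<notin># b"
      proof
        assume "v \<in># b"
        then obtain c where c: "b = add_mset v c" by (meson multi_member_split)
        then have "p = ?s (a, c)" "(a, c) \<in> ?S" using ab by auto
        then show False using p by blast
      qed
      then show "(case p of (a, b) \<Rightarrow> f a \<otimes> indexed_pmult g v b) = \<zero>"
        using assms ab by (simp add: indexed_pmult_def carrier_coeff_def)
    next
      fix p assume "p \<in> ?s ` ?S - {(a, b). a + b = m}"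
      then show "(case p of (a, b) \<Rightarrow> f a \<otimes> indexed_pmult g v b) = \<zero>"
        using True by auto
    qed (use assms in \<open>auto simp: carrier_coeff_def indexed_pmult_def\<close>)
    also have "\<dots> = finsum R (\<lambda>p. (\<lambda>(a, b). f a \<otimes> indexed_pmult g v b) (?s p)) ?S"
      using assms
      by (intro finsum_reindex) (auto simp: carrier_coeff_def inj_on_def indexed_pmult_def)
    also have "\<dots> = mpoly_mult R f g (m - {#v#})"
      unfolding mpoly_mult_def using assms
      by (intro finsum_cong') (auto simp: carrier_coeff_def indexed_pmult_def)
    finally show ?thesis using True by (simp add: indexed_pmult_def)
  qed
qed

lemma indexed_pmult_scale:
  "c \<in> carrier R \<Longrightarrow> indexed_pmult (\<lambda>m. f m \<otimes> c) v = (\<lambda>m. indexed_pmult f v m \<otimes> c)"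
  by (auto simp: indexed_pmult_def)

lemma mpoly_const_closed:
  fixes I :: "'v set"
  assumes "f \<in> indexed_pset I (carrier R)" "c \<in> carrier R"
  shows "mpoly_mult R f (indexed_const c) \<in> indexed_pset I (carrier R)"
  using assms(1)
proof induction
  case (indexed_const k)
  have "mpoly_mult R (indexed_const k) (indexed_const c :: 'v multiset \<Rightarrow> 'a) = indexed_const (k \<otimes> c)"
    using assms(2) indexed_const
    by (subst mpoly_mult_const) (auto simp: carrier_coeff_def indexed_const_def)
  then show ?case using indexed_const assms(2) by (auto intro: indexed_pset.intros)
next
  case (indexed_padd P Q)
  have P: "carrier_coeff P" "carrier_coeff Q" using indexed_padd.hyps by (auto dest: carrier_coeff_psetD)
  have "mpoly_mult R (indexed_padd P Q) (indexed_const c)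
      = indexed_padd (mpoly_mult R P (indexed_const c)) (mpoly_mult R Q (indexed_const c))"
    using P assms(2) indexed_padd_in_carrier[OF P]
    by (simp add: mpoly_mult_const) (auto simp: indexed_padd_def l_distr carrier_coeff_def)
  then show ?case using indexed_padd.IH by (auto intro: indexed_pset.intros)
next
  case (indexed_pmult P i)
  have P: "carrier_coeff P" using indexed_pmult.hyps by (auto dest: carrier_coeff_psetD)
  have "mpoly_mult R (indexed_pmult P i) (indexed_const c)
      = indexed_pmult (mpoly_mult R P (indexed_const c)) i"
    using P assms(2) indexed_pmult_in_carrier[OF P]
    by (simp add: mpoly_mult_const indexed_pmult_scale)
  then show ?case using indexed_pmult by (auto intro: indexed_pset.intros)
qed

lemma mpoly_mult_closed:
  assumes "f \<in> indexed_pset I (carrier R)" "g \<in> indexed_pset I (carrier R)"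
  shows "mpoly_mult R f g \<in> indexed_pset I (carrier R)"
  using assms(2)
proof induction
  case (indexed_const k)
  then show ?case using assms(1) mpoly_const_closed by blast
next
  case (indexed_padd P Q)
  then show ?case using assms(1)
    by (auto simp: mpoly_mult_padd carrier_coeff_psetD intro: indexed_pset.intros)
next
  case (indexed_pmult P i)
  then show ?case using assms(1)
    by (auto simp: mpoly_mult_pmult carrier_coeff_psetD intro: indexed_pset.intros)
qed

text \<open>Induction on the last factor: the rules for constants, sums and variables on the right
  move each operation outside both products.\<close>

lemma mpoly_mult_assoc:
  fixes f :: "'v multiset \<Rightarrow> 'a"
  assumes "carrier_coeff f" "carrier_coeff g" "h \<in> indexed_pset I (carrier R)"
  shows "mpoly_mult R (mpoly_mult R f g) h = mpoly_mult R f (mpoly_mult R g h)"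
  using assms(3)
proof induction
  case (indexed_const k)
  have k: "carrier_coeff (\<lambda>m. g m \<otimes> k)" using indexed_const assms by (auto simp: carrier_coeff_def)
  have "finsum R (\<lambda>(a, b). f a \<otimes> g b) {(a, b). a + b = m} \<otimes> k
      = finsum R (\<lambda>p. (case p of (a, b) \<Rightarrow> f a \<otimes> g b) \<otimes> k) {(a, b). a + b = m}" for m
    using assms indexed_const finite_sum_pairs
    by (intro finsum_ldistr) (auto simp: carrier_coeff_def)
  moreover have "finsum R (\<lambda>p. (case p of (a, b) \<Rightarrow> f a \<otimes> g b) \<otimes> k) {(a, b). a + b = m}
      = finsum R (\<lambda>(a, b). f a \<otimes> (g b \<otimes> k)) {(a, b). a + b = m}" for m
    using assms indexed_const by (intro finsum_cong') (auto simp: carrier_coeff_def m_assoc)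
  ultimately show ?case
    using assms indexed_const k mpoly_mult_coeff[OF assms(1,2)]
    by (simp add: mpoly_mult_const) (simp add: mpoly_mult_def)
next
  case (indexed_padd P Q)
  then show ?case using assms
    by (simp add: mpoly_mult_padd mpoly_mult_coeff carrier_coeff_psetD)
next
  case (indexed_pmult P i)
  then show ?case using assms
    by (simp add: mpoly_mult_pmult mpoly_mult_coeff carrier_coeff_psetD)
qed

lemma mpoly_ring_cring: "cring (mpoly_ring R I)"
proof -
  let ?A = "indexed_pset I (carrier R)"
  have one: "indexed_const \<one> \<in> ?A" "indexed_const \<zero> \<in> ?A"
    by (auto intro: indexed_pset.intros)
  have neg: "\<exists>g \<in> ?A. indexed_padd g f = indexed_const \<zero>" if f: "f \<in> ?A" for f
  proof (intro bexI)
    \<comment> \<open>Negation is multiplication by the constant minus one, so closure is inherited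
      from \<open>mpoly_const_closed\<close>.\<close>
    let ?g = "mpoly_mult R f (indexed_const (\<ominus> \<one>))"
    show "?g \<in> ?A" using f by (intro mpoly_const_closed) auto
    show "indexed_padd ?g f = indexed_const \<zero>"
      using carrier_coeff_psetD[OF f]
      by (simp add: mpoly_mult_const)
        (auto simp: indexed_padd_def indexed_const_def carrier_coeff_def r_minus l_neg)
  qed
  have c: "carrier_coeff f" if "f \<in> ?A" for f using that by (rule carrier_coeff_psetD)
  have padd_assoc: "indexed_padd (indexed_padd f g) h = indexed_padd f (indexed_padd g h)"
    if "f \<in> ?A" "g \<in> ?A" "h \<in> ?A" for f g h
    using that[THEN c] by (auto simp: indexed_padd_def carrier_coeff_def a_assoc)
  have padd_comm: "indexed_padd f g = indexed_padd g f" if "f \<in> ?A" "g \<in> ?A" for f g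
    using that[THEN c] by (auto simp: indexed_padd_def carrier_coeff_def a_comm)
  have mult_one: "mpoly_mult R (indexed_const \<one>) f = f" if f: "f \<in> ?A" for f
    using c[OF f] c[OF one(1)]
    by (subst mpoly_mult_comm) (auto simp: mpoly_mult_const carrier_coeff_def)
  show ?thesis
  proof (rule cringI)
    show "abelian_group (mpoly_ring R I)"
      by (rule abelian_groupI)
        (use neg in \<open>auto simp: mpoly_ring_simps padd_assoc one
          indexed_padd_zero c indexed_pset.intros intro: padd_comm\<close>)
    show "comm_monoid (mpoly_ring R I)"
      by (rule comm_monoidI)
        (auto simp: mpoly_ring_simps one mult_one mpoly_mult_closed mpoly_mult_assoc c
          intro: mpoly_mult_comm)
  next
    fix f g h
    assume "f \<in> carrier (mpoly_ring R I)" "g \<in> carrier (mpoly_ring R I)" "h \<in> carrier (mpoly_ring R I)"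
    then have f: "carrier_coeff f" "carrier_coeff g" "carrier_coeff h"
      by (simp_all add: mpoly_ring_simps c)
    have "mpoly_mult R (indexed_padd f g) h = mpoly_mult R h (indexed_padd f g)"
      using f indexed_padd_in_carrier by (intro mpoly_mult_comm)
    also have "\<dots> = indexed_padd (mpoly_mult R f h) (mpoly_mult R g h)"
      using f by (simp add: mpoly_mult_padd mpoly_mult_comm[of h])
    finally show "(f \<oplus>\<^bsub>mpoly_ring R I\<^esub> g) \<otimes>\<^bsub>mpoly_ring R I\<^esub> h
        = f \<otimes>\<^bsub>mpoly_ring R I\<^esub> h \<oplus>\<^bsub>mpoly_ring R I\<^esub> g \<otimes>\<^bsub>mpoly_ring R I\<^esub> h"
      by (simp add: mpoly_ring_simps)
  qed
qed

lemma indexed_const_hom: "indexed_const \<in> ring_hom R (mpoly_ring R I)"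
proof (rule ring_hom_memI)
  fix c d assume cd: "c \<in> carrier R" "d \<in> carrier R"
  then show "indexed_const (c \<otimes> d) = indexed_const c \<otimes>\<^bsub>mpoly_ring R I\<^esub> indexed_const d"
    by (simp add: mpoly_ring_simps mpoly_mult_const carrier_coeff_psetD indexed_pset.intros)
      (auto simp: indexed_const_def)
qed (auto simp: mpoly_ring_simps indexed_padd_const intro: indexed_pset.intros)

end

section \<open>Evaluation of polynomials at a point\<close>

definition mpoly_eval ::
    "('a, 'm) ring_scheme \<Rightarrow> ('v \<Rightarrow> 'a) \<Rightarrow> ('v multiset \<Rightarrow> 'a) \<Rightarrow> 'a" where
  "mpoly_eval R a f = (\<Oplus>\<^bsub>R\<^esub>m \<in> {m. f m \<noteq> \<zero>\<^bsub>R\<^esub>}.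
    f m \<otimes>\<^bsub>R\<^esub> (\<Otimes>\<^bsub>R\<^esub>v \<in> set_mset m. a v [^]\<^bsub>R\<^esub> count m v))"

context cring
begin

context
  fixes a :: "'v \<Rightarrow> 'a"
  assumes a: "a \<in> UNIV \<rightarrow> carrier R"
begin

lemma monomial_value_closed: "(\<Otimes>v \<in> set_mset m. a v [^] count m v) \<in> carrier R"
  using a by (intro finprod_closed) auto

lemma monomial_value_add:
  "(\<Otimes>v \<in> set_mset (add_mset w m). a v [^] count (add_mset w m) v)
    = (\<Otimes>v \<in> set_mset m. a v [^] count m v) \<otimes> a w"
proof -
  \<comment> \<open>Over this common index set the exponents differ only at \<open>w\<close>; if
    \<open>w\<close> does not occur in \<open>m\<close>, its old exponent is zero and gives the
    factor one.\<close>
  let ?A = "insert w (set_mset m)"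
  have aw: "a v \<in> carrier R" for v using a by auto
  have "(\<Otimes>v \<in> ?A. a v [^] count (add_mset w m) v)
      = (\<Otimes>v \<in> ?A. a v [^] count m v \<otimes> (if v = w then a v else \<one>))"
    using aw by (intro finprod_cong') auto
  also have "\<dots> = (\<Otimes>v \<in> ?A. a v [^] count m v) \<otimes> (\<Otimes>v \<in> ?A. if v = w then a v else \<one>)"
    using a by (intro finprod_multf) auto
  also have "(\<Otimes>v \<in> ?A. if v = w then a v else \<one>) = a w"
    using a by (intro finprod_singleton_swap) auto
  also have "(\<Otimes>v \<in> ?A. a v [^] count m v) = (\<Otimes>v \<in> set_mset m. a v [^] count m v)"
    by (rule finprod_mono_neutral_cong)
      (use aw in \<open>auto simp: not_in_iff\<close>)
  finally show ?thesis by simp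
qed

text \<open>Cancellation can make the support of a sum smaller than the union of the supports, so
  additivity compares evaluations over one common finite set.\<close>

lemma mpoly_eval_superset:
  assumes "carrier_coeff f" "finite A" "{m. f m \<noteq> \<zero>} \<subseteq> A"
  shows "mpoly_eval R a f = (\<Oplus>m \<in> A. f m \<otimes> (\<Otimes>v \<in> set_mset m. a v [^] count m v))"
  unfolding mpoly_eval_def
  by (rule add.finprod_mono_neutral_cong_left)
    (use assms in \<open>auto simp: carrier_coeff_def monomial_value_closed\<close>)

lemma mpoly_eval_const: "c \<in> carrier R \<Longrightarrow> mpoly_eval R a (indexed_const c) = c"
  by (subst mpoly_eval_superset[where A = "{{#}}"])
    (auto simp: indexed_const_def carrier_coeff_def)

lemma mpoly_eval_padd:
  assumes "f \<in> indexed_pset I (carrier R)" "g \<in> indexed_pset I (carrier R)"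
  shows "mpoly_eval R a (indexed_padd f g) = mpoly_eval R a f \<oplus> mpoly_eval R a g"
proof -
  note c = assms[THEN carrier_coeff_psetD]
  let ?A = "{m. f m \<noteq> \<zero>} \<union> {m. g m \<noteq> \<zero>}"
  have fin: "finite ?A" using assms[THEN finite_support] by auto
  have "mpoly_eval R a (indexed_padd f g) = (\<Oplus>m \<in> ?A.
      f m \<otimes> (\<Otimes>v \<in> set_mset m. a v [^] count m v) \<oplus> g m \<otimes> (\<Otimes>v \<in> set_mset m. a v [^] count m v))"
    using c fin by (subst mpoly_eval_superset[where A = ?A])
      (auto simp: indexed_padd_def carrier_coeff_def l_distr monomial_value_closed intro!: finsum_cong')
  also have "\<dots> = (\<Oplus>m \<in> ?A. f m \<otimes> (\<Otimes>v \<in> set_mset m. a v [^] count m v))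
      \<oplus> (\<Oplus>m \<in> ?A. g m \<otimes> (\<Otimes>v \<in> set_mset m. a v [^] count m v))"
    using c by (intro finsum_addf) (auto simp: carrier_coeff_def monomial_value_closed)
  also have "\<dots> = mpoly_eval R a f \<oplus> mpoly_eval R a g"
    using c fin mpoly_eval_superset[of f ?A] mpoly_eval_superset[of g ?A] by auto
  finally show ?thesis .
qed

lemma mpoly_eval_pmult:
  assumes "f \<in> indexed_pset I (carrier R)"
  shows "mpoly_eval R a (indexed_pmult f w) = mpoly_eval R a f \<otimes> a w"
proof -
  note c = assms[THEN carrier_coeff_psetD]
  have fin: "finite {m. f m \<noteq> \<zero>}" using assms by (rule finite_support)
  have S: "{m. indexed_pmult f w m \<noteq> \<zero>} = add_mset w ` {m. f m \<noteq> \<zero>}"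
    by (auto simp: indexed_pmult_def image_iff intro!: exI[of _ "_ - {#w#}"] split: if_splits)
  have aw: "a w \<in> carrier R" using a by auto
  have "mpoly_eval R a (indexed_pmult f w) = (\<Oplus>m \<in> {m. f m \<noteq> \<zero>}. indexed_pmult f w (add_mset w m)
      \<otimes> (\<Otimes>v \<in> set_mset (add_mset w m). a v [^] count (add_mset w m) v))"
    unfolding mpoly_eval_def S using c indexed_pmult_in_carrier[OF c]
    by (intro finsum_reindex)
      (auto simp: carrier_coeff_def inj_on_def intro!: m_closed monomial_value_closed)
  also have "\<dots> = (\<Oplus>m \<in> {m. f m \<noteq> \<zero>}. f m \<otimes> (\<Otimes>v \<in> set_mset m. a v [^] count m v) \<otimes> a w)"
    using c aw unfolding monomial_value_add
    by (intro finsum_cong')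
      (auto simp: indexed_pmult_def carrier_coeff_def monomial_value_closed m_assoc)
  also have "\<dots> = mpoly_eval R a f \<otimes> a w"
    unfolding mpoly_eval_def using c aw fin
    by (intro finsum_ldistr[symmetric]) (auto simp: carrier_coeff_def monomial_value_closed)
  finally show ?thesis .
qed

lemma mpoly_eval_closed:
  "f \<in> indexed_pset I (carrier R) \<Longrightarrow> mpoly_eval R a f \<in> carrier R"
  unfolding mpoly_eval_def
  by (intro finsum_closed) (auto simp: carrier_coeffE carrier_coeff_psetD monomial_value_closed)

lemma mpoly_eval_hom: "mpoly_eval R a \<in> ring_hom (mpoly_ring R I) R"
proof (rule ring_hom_memI)
  fix f g assume "f \<in> carrier (mpoly_ring R I)" "g \<in> carrier (mpoly_ring R I)"
  then have fg: "f \<in> indexed_pset I (carrier R)" "g \<in> indexed_pset I (carrier R)"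
    by (simp_all add: mpoly_ring_simps)
  note c = carrier_coeff_psetD[of _ I]
  have sc: "mpoly_eval R a (mpoly_mult R f (indexed_const k)) = mpoly_eval R a f \<otimes> k"
    if k: "k \<in> carrier R" for k
  proof -
    have fin: "finite {m. f m \<noteq> \<zero>}" using fg(1) by (rule finite_support)
    have "mpoly_eval R a (\<lambda>m. f m \<otimes> k)
        = (\<Oplus>m \<in> {m. f m \<noteq> \<zero>}. f m \<otimes> (\<Otimes>v \<in> set_mset m. a v [^] count m v) \<otimes> k)"
      using fg(1)[THEN c] k fin by (subst mpoly_eval_superset[where A = "{m. f m \<noteq> \<zero>}"])
        (auto simp: carrier_coeff_def monomial_value_closed m_ac intro!: finsum_cong')
    also have "\<dots> = mpoly_eval R a f \<otimes> k"
      unfolding mpoly_eval_def using fg(1)[THEN c] k fin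
      by (intro finsum_ldistr[symmetric]) (auto simp: carrier_coeff_def monomial_value_closed)
    finally show ?thesis using k fg by (simp add: mpoly_mult_const c)
  qed
  have "mpoly_eval R a (mpoly_mult R f g) = mpoly_eval R a f \<otimes> mpoly_eval R a g"
    using fg(2)
  proof induction
    case (indexed_const k)
    then show ?case using sc by (simp add: mpoly_eval_const)
  next
    case (indexed_padd P Q)
    then show ?case using fg(1)
      by (simp add: mpoly_mult_padd c mpoly_eval_padd[of _ I] mpoly_mult_closed mpoly_eval_closed[of _ I] r_distr)
  next
    case (indexed_pmult P i)
    have "a i \<in> carrier R" using a by auto
    then show ?case using fg(1) indexed_pmult
      by (simp add: mpoly_mult_pmult c mpoly_eval_pmult[of _ I] mpoly_mult_closed mpoly_eval_closed[of _ I] m_assoc)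
  qed
  then show "mpoly_eval R a (f \<otimes>\<^bsub>mpoly_ring R I\<^esub> g) = mpoly_eval R a f \<otimes> mpoly_eval R a g"
    by (simp add: mpoly_ring_simps)
  show "mpoly_eval R a (f \<oplus>\<^bsub>mpoly_ring R I\<^esub> g) = mpoly_eval R a f \<oplus> mpoly_eval R a g"
    using fg by (simp add: mpoly_ring_simps mpoly_eval_padd)
qed (auto simp: mpoly_ring_simps mpoly_eval_closed mpoly_eval_const)

end

text \<open>Later this replaces an injective choice of points by a permutation that agrees with it
  on the finitely many blocks that occur.\<close>

lemma mpoly_eval_cong:
  assumes "f \<in> indexed_pset I (carrier R)" "a \<in> UNIV \<rightarrow> carrier R" "b \<in> UNIV \<rightarrow> carrier R"
    and "\<And>v. v \<in> I \<Longrightarrow> a v = b v"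
  shows "mpoly_eval R a f = mpoly_eval R b f"
  using assms(1) by induction (simp_all add: assms mpoly_eval_const mpoly_eval_padd[of _ _ I] mpoly_eval_pmult[of _ _ I])

section \<open>Renaming of variables\<close>

lemma finite_rename_fibre:
  assumes "f \<in> indexed_pset I (carrier R)"
  shows "finite {m. f m \<noteq> \<zero> \<and> image_mset \<phi> m = m'}"
  using finite_support[OF assms] by (rule rev_finite_subset) auto

lemma mpoly_rename_const:
  fixes \<phi> :: "'v \<Rightarrow> 'w"
  assumes "c \<in> carrier R"
  shows "mpoly_rename R \<phi> (indexed_const c) = indexed_const c"
proof
  fix m'
  have "(\<Oplus>m \<in> {m. indexed_const c m \<noteq> \<zero> \<and> image_mset \<phi> m = m'}. indexed_const c m)
      = (\<Oplus>m \<in> {{#} :: 'v multiset}. if m' = {#} then c else \<zero>)"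
    by (rule add.finprod_mono_neutral_cong_left)
      (use assms in \<open>auto simp: indexed_const_def split: if_splits\<close>)
  then show "mpoly_rename R \<phi> (indexed_const c) m' = indexed_const c m'"
    using assms by (simp add: mpoly_rename_def indexed_const_def)
qed

lemma mpoly_rename_padd:
  assumes "f \<in> indexed_pset I (carrier R)" "g \<in> indexed_pset I (carrier R)"
  shows "mpoly_rename R \<phi> (indexed_padd f g) = indexed_padd (mpoly_rename R \<phi> f) (mpoly_rename R \<phi> g)"
proof
  fix m'
  note c = assms[THEN carrier_coeff_psetD, unfolded carrier_coeff_def, rule_format]
  let ?A = "{m. f m \<noteq> \<zero> \<and> image_mset \<phi> m = m'} \<union> {m. g m \<noteq> \<zero> \<and> image_mset \<phi> m = m'}"
  have fin: "finite ?A" using assms finite_rename_fibre by blast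
  have "mpoly_rename R \<phi> (indexed_padd f g) m' = (\<Oplus>m \<in> ?A. f m \<oplus> g m)"
    unfolding mpoly_rename_def
    by (rule add.finprod_mono_neutral_cong_left) (use c fin in \<open>auto simp: indexed_padd_def\<close>)
  also have "\<dots> = (\<Oplus>m \<in> ?A. f m) \<oplus> (\<Oplus>m \<in> ?A. g m)"
    using c by (intro finsum_addf) auto
  also have "(\<Oplus>m \<in> ?A. f m) = mpoly_rename R \<phi> f m'"
    unfolding mpoly_rename_def
    by (rule add.finprod_mono_neutral_cong_right) (use c fin in auto)
  also have "(\<Oplus>m \<in> ?A. g m) = mpoly_rename R \<phi> g m'"
    unfolding mpoly_rename_def
    by (rule add.finprod_mono_neutral_cong_right) (use c fin in auto)
  finally show "mpoly_rename R \<phi> (indexed_padd f g) m'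
      = indexed_padd (mpoly_rename R \<phi> f) (mpoly_rename R \<phi> g) m'"
    by (simp add: indexed_padd_def)
qed

lemma mpoly_rename_pmult:
  assumes "carrier_coeff f"
  shows "mpoly_rename R \<phi> (indexed_pmult f w) = indexed_pmult (mpoly_rename R \<phi> f) (\<phi> w)"
proof
  fix m'
  let ?B = "{m. f m \<noteq> \<zero> \<and> image_mset \<phi> (add_mset w m) = m'}"
  have S: "{m. indexed_pmult f w m \<noteq> \<zero> \<and> image_mset \<phi> m = m'} = add_mset w ` ?B"
  proof (intro Set.set_eqI iffI)
    fix m assume "m \<in> {m. indexed_pmult f w m \<noteq> \<zero> \<and> image_mset \<phi> m = m'}"
    then have m: "w \<in># m" "f (m - {#w#}) \<noteq> \<zero>" "image_mset \<phi> m = m'"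
      by (auto simp: indexed_pmult_def split: if_splits)
    then obtain m\<^sub>0 where "m = add_mset w m\<^sub>0" by (meson multi_member_split)
    then show "m \<in> add_mset w ` ?B" using m by auto
  qed (auto simp: indexed_pmult_def)
  have "mpoly_rename R \<phi> (indexed_pmult f w) m' = (\<Oplus>m \<in> ?B. indexed_pmult f w (add_mset w m))"
    unfolding mpoly_rename_def S using indexed_pmult_in_carrier[OF assms]
    by (intro finsum_reindex) (auto simp: carrier_coeff_def inj_on_def)
  also have "\<dots> = (\<Oplus>m \<in> ?B. f m)"
    by (simp add: indexed_pmult_def)
  also have "\<dots> = indexed_pmult (mpoly_rename R \<phi> f) (\<phi> w) m'"
  proof (cases "\<phi> w \<in># m'")
    case True
    then have "image_mset \<phi> (add_mset w m) = m' \<longleftrightarrow> image_mset \<phi> m = m' - {#\<phi> w#}" for m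
      by (metis add_mset_remove_trivial image_mset_add_mset insert_DiffM)
    then show ?thesis using True by (simp only: indexed_pmult_def mpoly_rename_def if_True)
  next
    case False
    then have "?B = {}" by auto
    then show ?thesis using False by (simp only: indexed_pmult_def finsum_empty if_False)
  qed
  finally show "mpoly_rename R \<phi> (indexed_pmult f w) m' = \<dots>" .
qed

lemma mpoly_rename_closed:
  assumes "f \<in> indexed_pset I (carrier R)" "\<phi> ` I \<subseteq> J"
  shows "mpoly_rename R \<phi> f \<in> indexed_pset J (carrier R)"
  using assms(1)
  by induction (use assms(2) in \<open>auto simp: mpoly_rename_const mpoly_rename_padd[of _ I]
    mpoly_rename_pmult carrier_coeff_psetD[of _ I] intro!: indexed_pset.intros\<close>)

lemma mpoly_rename_hom:
  assumes \<phi>: "\<phi> ` I \<subseteq> J"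
  shows "mpoly_rename R \<phi> \<in> ring_hom (mpoly_ring R I) (mpoly_ring R J)"
proof (rule ring_hom_memI)
  fix f g assume "f \<in> carrier (mpoly_ring R I)" "g \<in> carrier (mpoly_ring R I)"
  then have fg: "f \<in> indexed_pset I (carrier R)" "g \<in> indexed_pset I (carrier R)"
    by (simp_all add: mpoly_ring_simps)
  note c = carrier_coeff_psetD
  have sc: "mpoly_rename R \<phi> (mpoly_mult R f (indexed_const k))
      = mpoly_mult R (mpoly_rename R \<phi> f) (indexed_const k)" if k: "k \<in> carrier R" for k
  proof
    fix m'
    have "mpoly_rename R \<phi> (\<lambda>m. f m \<otimes> k) m' = (\<Oplus>m \<in> {m. f m \<noteq> \<zero> \<and> image_mset \<phi> m = m'}. f m \<otimes> k)"
      unfolding mpoly_rename_def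
      by (rule add.finprod_mono_neutral_cong_left)
        (use c[OF fg(1)] k finite_rename_fibre[OF fg(1)] in \<open>auto simp: carrier_coeff_def\<close>)
    also have "\<dots> = mpoly_rename R \<phi> f m' \<otimes> k"
      unfolding mpoly_rename_def
      using c[OF fg(1)] k finite_rename_fibre[OF fg(1)]
      by (intro finsum_ldistr[symmetric]) (auto simp: carrier_coeff_def)
    finally show "mpoly_rename R \<phi> (mpoly_mult R f (indexed_const k)) m'
        = mpoly_mult R (mpoly_rename R \<phi> f) (indexed_const k) m'"
      using k c[OF fg(1)] c[OF mpoly_rename_closed[OF fg(1) \<phi>]] by (simp add: mpoly_mult_const)
  qed
  have "mpoly_rename R \<phi> (mpoly_mult R f g) = mpoly_mult R (mpoly_rename R \<phi> f) (mpoly_rename R \<phi> g)"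
    using fg(2)
  proof induction
    case (indexed_const k)
    then show ?case using sc by (simp add: mpoly_rename_const)
  next
    case (indexed_padd P Q)
    then show ?case using fg(1) mpoly_rename_closed[OF _ \<phi>]
      by (simp add: mpoly_mult_padd c[of _ I] mpoly_rename_padd[of _ I] mpoly_mult_closed c[of _ J])
  next
    case (indexed_pmult P i)
    then show ?case using fg(1) mpoly_rename_closed[OF _ \<phi>]
      by (simp add: mpoly_mult_pmult c[of _ I] mpoly_rename_pmult mpoly_mult_coeff c[of _ J])
  qed
  then show "mpoly_rename R \<phi> (f \<otimes>\<^bsub>mpoly_ring R I\<^esub> g)
      = mpoly_rename R \<phi> f \<otimes>\<^bsub>mpoly_ring R J\<^esub> mpoly_rename R \<phi> g"
    by (simp add: mpoly_ring_simps)
  show "mpoly_rename R \<phi> (f \<oplus>\<^bsub>mpoly_ring R I\<^esub> g)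
      = mpoly_rename R \<phi> f \<oplus>\<^bsub>mpoly_ring R J\<^esub> mpoly_rename R \<phi> g"
    using fg by (simp add: mpoly_ring_simps mpoly_rename_padd)
qed (auto simp: mpoly_ring_simps mpoly_rename_const mpoly_rename_closed[OF _ \<phi>])

text \<open>Renaming variables is dual to pulling back the point. This turns the action of
  \<open>Sym_inf\<close> into a permutation of the points, and the copy of a polynomial in one block
  into its value at the point placed there.\<close>

lemma mpoly_eval_rename:
  assumes "f \<in> indexed_pset I (carrier R)" "a \<in> UNIV \<rightarrow> carrier R"
  shows "mpoly_eval R a (mpoly_rename R \<phi> f) = mpoly_eval R (a \<circ> \<phi>) f"
proof -
  have a': "a \<circ> \<phi> \<in> UNIV \<rightarrow> carrier R" using assms(2) by auto
  have cl: "P \<in> indexed_pset I (carrier R) \<Longrightarrow> mpoly_rename R \<phi> P \<in> indexed_pset UNIV (carrier R)" for P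
    by (erule mpoly_rename_closed) simp
  define b where "b = a \<circ> \<phi>"
  have b: "b \<in> UNIV \<rightarrow> carrier R" "a (\<phi> v) = b v" for v using a' by (simp_all add: b_def)
  have "mpoly_eval R a (mpoly_rename R \<phi> f) = mpoly_eval R b f" using assms(1)
    by induction (simp_all add: assms(2) b cl mpoly_rename_const mpoly_rename_padd[of _ I]
      mpoly_rename_pmult carrier_coeff_psetD[of _ I] mpoly_eval_const mpoly_eval_padd[OF b(1), of _ I]
      mpoly_eval_padd[OF assms(2), of _ UNIV] mpoly_eval_pmult[OF b(1), of _ I]
      mpoly_eval_pmult[OF assms(2), of _ UNIV])
  then show ?thesis by (simp add: b_def)
qed

end

section \<open>Extension of coefficients and the universal property\<close>

lemma mpoly_map_simps:
  assumes "h \<in> ring_hom K L" "cring K" "cring L"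
  shows "c \<in> carrier K \<Longrightarrow> h \<circ> ring.indexed_const K c = ring.indexed_const L (h c)"
    "ring.carrier_coeff K f \<Longrightarrow> ring.carrier_coeff K g \<Longrightarrow>
      h \<circ> ring.indexed_padd K f g = ring.indexed_padd L (h \<circ> f) (h \<circ> g)"
    "ring.carrier_coeff K f \<Longrightarrow> h \<circ> ring.indexed_pmult K f v = ring.indexed_pmult L (h \<circ> f) v"
proof -
  interpret K: cring K by fact
  interpret L: cring L by fact
  interpret h: ring_hom_cring K L h
    by unfold_locales (rule assms(1))
  show "c \<in> carrier K \<Longrightarrow> h \<circ> K.indexed_const c = L.indexed_const (h c)"
    by (auto simp: K.indexed_const_def L.indexed_const_def)
  show "K.carrier_coeff f \<Longrightarrow> K.carrier_coeff g \<Longrightarrow>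
      h \<circ> K.indexed_padd f g = L.indexed_padd (h \<circ> f) (h \<circ> g)"
    by (auto simp: K.indexed_padd_def L.indexed_padd_def K.carrier_coeff_def)
  show "K.carrier_coeff f \<Longrightarrow> h \<circ> K.indexed_pmult f v = L.indexed_pmult (h \<circ> f) v"
    by (auto simp: K.indexed_pmult_def L.indexed_pmult_def)
qed

lemma mpoly_map_closed:
  assumes "h \<in> ring_hom K L" "cring K" "cring L" "f \<in> ring.indexed_pset K I (carrier K)"
  shows "h \<circ> f \<in> ring.indexed_pset L I (carrier L)"
proof -
  interpret K: cring K by fact
  interpret L: cring L by fact
  note * = mpoly_map_simps[OF assms(1-3)] K.carrier_coeff_psetD ring_hom_memE(1)[OF assms(1)]
  show ?thesis using assms(4)
  proof (induction rule: K.indexed_pset.induct)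
    case (indexed_const k)
    then show ?case unfolding *(1)[OF indexed_const] by (intro L.indexed_pset.intros *)
  next
    case (indexed_padd P Q)
    then show ?case
      unfolding *(2)[OF *(4)[OF indexed_padd.hyps(1)] *(4)[OF indexed_padd.hyps(2)]] by (intro L.indexed_pset.intros)
  next
    case (indexed_pmult P i)
    then show ?case
      unfolding *(3)[OF *(4)[OF indexed_pmult.hyps(1)]] by (intro L.indexed_pset.intros)
  qed
qed

lemma mpoly_map_rename:
  assumes "h \<in> ring_hom K L" "cring K" "cring L" "f \<in> ring.indexed_pset K I (carrier K)"
  shows "h \<circ> mpoly_rename K \<phi> f = mpoly_rename L \<phi> (h \<circ> f)"
proof -
  interpret K: cring K by fact
  interpret L: cring L by fact
  note * = mpoly_map_simps[OF assms(1-3)] K.carrier_coeff_psetD[of _ I]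
  note ** = K.carrier_coeff_psetD[OF K.mpoly_rename_closed[of _ I \<phi> UNIV]]
  show ?thesis using assms(4)
  proof (induction rule: K.indexed_pset.induct)
    case (indexed_const k)
    then show ?case
      by (simp del: comp_def add: *(1) K.mpoly_rename_const L.mpoly_rename_const ring_hom_memE(1)[OF assms(1)])
  next
    case (indexed_padd P Q)
    note PQ = indexed_padd.hyps
    have cl: "h \<circ> P \<in> L.indexed_pset I (carrier L)" "h \<circ> Q \<in> L.indexed_pset I (carrier L)"
      using PQ by (auto intro: mpoly_map_closed[OF assms(1-3)])
    have "h \<circ> mpoly_rename K \<phi> (K.indexed_padd P Q)
        = L.indexed_padd (h \<circ> mpoly_rename K \<phi> P) (h \<circ> mpoly_rename K \<phi> Q)"
      using PQ by (simp only: K.mpoly_rename_padd[of _ I] *(2) **[OF _ subset_UNIV])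
    also have "\<dots> = mpoly_rename L \<phi> (L.indexed_padd (h \<circ> P) (h \<circ> Q))"
      using indexed_padd.IH by (simp only: L.mpoly_rename_padd[OF cl])
    also have "\<dots> = mpoly_rename L \<phi> (h \<circ> K.indexed_padd P Q)"
      using PQ by (simp only: *(2,4))
    finally show ?case .
  next
    case (indexed_pmult P v)
    note P = indexed_pmult.hyps(1)
    have cl: "h \<circ> P \<in> L.indexed_pset I (carrier L)"
      using P by (rule mpoly_map_closed[OF assms(1-3)])
    have "h \<circ> mpoly_rename K \<phi> (K.indexed_pmult P v) = L.indexed_pmult (h \<circ> mpoly_rename K \<phi> P) (\<phi> v)"
      using P by (simp only: K.mpoly_rename_pmult *(3,4) **[OF _ subset_UNIV])
    also have "\<dots> = mpoly_rename L \<phi> (L.indexed_pmult (h \<circ> P) v)"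
      using indexed_pmult.IH by (simp only: L.mpoly_rename_pmult[OF L.carrier_coeff_psetD[OF cl]])
    also have "\<dots> = mpoly_rename L \<phi> (h \<circ> K.indexed_pmult P v)"
      using P by (simp only: *(3,4))
    finally show ?case .
  qed
qed

text \<open>Both sides agree on constants and respect sums and multiplication by a variable. Zero is
  a default value outside \<open>I\<close> that keeps the point total with values in
  \<open>carrier L\<close>.\<close>

lemma mpoly_hom_eq_eval:
  assumes "cring K" "cring L" and \<phi>: "\<phi> \<in> ring_hom (mpoly_ring K I) L"
    and f: "f \<in> carrier (mpoly_ring K I)"
  shows "\<phi> f = mpoly_eval L (\<lambda>v. if v \<in> I then \<phi> (ring.indexed_var K v) else \<zero>\<^bsub>L\<^esub>)
    ((\<phi> \<circ> ring.indexed_const K) \<circ> f)" (is "_ = mpoly_eval L ?\<xi> (?h \<circ> f)")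
proof -
  interpret K: cring K by fact
  interpret L: cring L by fact
  interpret A: cring "mpoly_ring K I" by (rule K.mpoly_ring_cring)
  interpret \<phi>: ring_hom_cring "mpoly_ring K I" L \<phi> by unfold_locales (rule \<phi>)
  have h': "?h \<in> ring_hom K L" by (rule ring_hom_trans[OF K.indexed_const_hom \<phi>])
  have var: "K.indexed_var v \<in> K.indexed_pset I (carrier K)" if "v \<in> I" for v
    unfolding K.indexed_var_def using that by (auto intro: K.indexed_pset.intros)
  have \<xi>: "?\<xi> \<in> UNIV \<rightarrow> carrier L" using var by (auto simp: mpoly_ring_simps)
  define h where "h = ?h"
  define a where "a = ?\<xi>"
  note h = h'[folded h_def] and \<xi> = \<xi>[folded a_def]
  note map = mpoly_map_simps[OF h K.is_cring L.is_cring]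
  note cl = mpoly_map_closed[OF h K.is_cring L.is_cring, of _ I]
  have "f \<in> K.indexed_pset I (carrier K)" using f by (simp add: mpoly_ring_simps)
  then have "\<phi> f = mpoly_eval L a (h \<circ> f)"
  proof (induction rule: K.indexed_pset.induct)
    case (indexed_const k)
    then show ?case
      unfolding map(1)[OF indexed_const]
      by (simp add: L.mpoly_eval_const[OF \<xi>] ring_hom_memE(1)[OF h]) (simp add: h_def)
  next
    case (indexed_padd P Q)
    have "\<phi> (K.indexed_padd P Q) = \<phi> P \<oplus>\<^bsub>L\<^esub> \<phi> Q"
      using \<phi>.hom_add[of P Q] indexed_padd.hyps by (simp add: mpoly_ring_simps)
    then show ?case
      unfolding map(2)[OF K.carrier_coeff_psetD[OF indexed_padd.hyps(1)] K.carrier_coeff_psetD[OF indexed_padd.hyps(2)]]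
        L.mpoly_eval_padd[OF \<xi> cl[OF indexed_padd.hyps(1)] cl[OF indexed_padd.hyps(2)]]
      by (simp only: indexed_padd.IH)
  next
    case (indexed_pmult P v)
    note co = K.carrier_coeff_psetD[OF indexed_pmult.hyps(1)]
    \<comment> \<open>\<open>indexed_pmult\<close> is rewritten as a product with the polynomial
      \<open>indexed_var v\<close>, to which multiplicativity of \<open>\<phi>\<close>
      applies.\<close>
    have "mpoly_mult K P (K.indexed_var v) = K.indexed_pmult (mpoly_mult K P (K.indexed_const \<one>\<^bsub>K\<^esub>)) v"
      unfolding K.indexed_var_def
      by (rule K.mpoly_mult_pmult[OF co]) (auto simp: K.carrier_coeff_def K.indexed_const_def)
    also have "mpoly_mult K P (K.indexed_const \<one>\<^bsub>K\<^esub>) = P"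
      using co by (simp add: K.mpoly_mult_const K.carrier_coeff_def)
    finally have "\<phi> (K.indexed_pmult P v) = \<phi> P \<otimes>\<^bsub>L\<^esub> \<phi> (K.indexed_var v)"
      using \<phi>.hom_mult[of P "K.indexed_var v"] indexed_pmult.hyps var by (simp add: mpoly_ring_simps)
    also have "\<phi> (K.indexed_var v) = a v" using indexed_pmult.hyps(2) by (simp add: a_def)
    finally show ?case
      unfolding map(3)[OF co] L.mpoly_eval_pmult[OF \<xi> cl[OF indexed_pmult.hyps(1)]]
      by (simp only: indexed_pmult.IH)
  qed
  then show ?thesis by (simp only: h_def a_def)
qed

section \<open>Elimination along an ultrafilter\<close>

text \<open>Zorn's lemma for the reversed order of filters, where smaller means finer: a minimal
  proper filter below \<open>cofinite\<close> is an ultrafilter, and lying below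
  \<open>cofinite\<close> makes it nonprincipal.\<close>

lemma exists_nonprincipal_ultrafilter:
  "\<exists>U :: nat filter. (\<forall>P. eventually P U \<or> eventually (\<lambda>i. \<not> P i) U) \<and> U \<noteq> bot \<and> U \<le> cofinite"
proof -
  let ?A = "{U :: nat filter. U \<noteq> bot \<and> U \<le> cofinite}"
  have "\<exists>U \<in> ?A. \<forall>F \<in> ?A. F \<le> U \<longrightarrow> F = U"
  proof (rule predicate_Zorn)
    show "partial_order_on ?A (relation_of (\<ge>) ?A)"
      by (auto simp: partial_order_on_def preorder_on_def refl_on_def trans_def antisym_def relation_of_def)
  next
    fix C assume C: "C \<in> Chains (relation_of (\<ge>) ?A)"
    then have CA: "C \<subseteq> ?A" and lin: "\<And>F G. F \<in> C \<Longrightarrow> G \<in> C \<Longrightarrow> F \<le> G \<or> G \<le> F"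
      by (auto simp: Chains_def relation_of_def)
    show "\<exists>U \<in> ?A. \<forall>F \<in> C. U \<le> F"
    proof (cases "C = {}")
      case True
      then show ?thesis by (intro bexI[of _ cofinite]) auto
    next
      case False
      \<comment> \<open>A chain is directed, so what holds eventually for the infimum already holds
        eventually for some member; hence the infimum stays proper.\<close>
      have "eventually P (Inf C) \<longleftrightarrow> (\<exists>F \<in> C. eventually P F)" for P
        using False lin by (intro eventually_Inf_base) (metis inf.idem inf_le1 le_inf_iff order_refl)+
      then have "Inf C \<noteq> bot"
        using CA by (auto simp: trivial_limit_def)
      moreover have "Inf C \<le> cofinite"
      proof -
        obtain F where "F \<in> C" using False by blast
        then show ?thesis using CA Inf_lower2[of F C cofinite] by blast
      qed
      ultimately show ?thesis by (intro bexI[of _ "Inf C"]) (auto intro: Inf_lower)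
    qed
  qed
  then obtain U where UA: "U \<in> ?A" and "\<forall>F \<in> ?A. F \<le> U \<longrightarrow> F = U" by blast
  then have U: "U \<noteq> bot" "U \<le> cofinite"
    and min: "\<And>F. F \<noteq> bot \<Longrightarrow> F \<le> cofinite \<Longrightarrow> F \<le> U \<Longrightarrow> F = U"
    by auto
  have "eventually P U \<or> eventually (\<lambda>i. \<not> P i) U" for P
  proof (rule disjCI)
    assume n: "\<not> eventually (\<lambda>i. \<not> P i) U"
    \<comment> \<open>Restricting \<open>U\<close> to \<open>P\<close> keeps it proper when the
      negation of \<open>P\<close> is not eventual, so minimality forces the restriction to equal
      \<open>U\<close>.\<close>
    let ?F = "inf U (principal {i. P i})"
    have "?F \<noteq> bot"
      using n by (simp add: trivial_limit_def eventually_inf_principal)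
    moreover have "?F \<le> U" by simp
    ultimately have "?F = U" using min U(2) order_trans[of ?F U cofinite] by blast
    moreover have "eventually P ?F" by (simp add: eventually_inf_principal)
    ultimately show "eventually P U" by simp
  qed
  then show ?thesis using U by blast
qed

section \<open>Gaussian elimination on sums of products\<close>

lemma (in ideal) mem_of_minus_mem:
  assumes "b \<ominus> a \<in> I" "a \<in> I" "b \<in> carrier R" shows "b \<in> I"
proof -
  have "(b \<ominus> a) \<oplus> a \<in> I" using assms by auto
  also have "(b \<ominus> a) \<oplus> a = b"
    using assms Icarr by (simp add: a_minus_def a_assoc l_neg)
  finally show ?thesis .
qed

text \<open>Encodes a polynomial as the sum of products of coefficients \<open>E\<close> in earlier
  blocks and polynomials \<open>G\<close> in the last block. The map \<open>\<rho>\<close> is a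
  parameter so that one list can be read with the last block either kept as variables or specialised
  to a point.\<close>

definition pair_sum ::
    "('a, 'm) ring_scheme \<Rightarrow> ('b \<Rightarrow> 'a) \<Rightarrow> ('a \<times> 'b) list \<Rightarrow> 'a" where
  "pair_sum A \<rho> ps = foldr (\<lambda>(E, G) s. E \<otimes>\<^bsub>A\<^esub> \<rho> G \<oplus>\<^bsub>A\<^esub> s) ps \<zero>\<^bsub>A\<^esub>"

lemma pair_sum_simps [simp]:
  "pair_sum A \<rho> [] = \<zero>\<^bsub>A\<^esub>"
  "pair_sum A \<rho> ((E, G) # ps) = E \<otimes>\<^bsub>A\<^esub> \<rho> G \<oplus>\<^bsub>A\<^esub> pair_sum A \<rho> ps"
  by (simp_all add: pair_sum_def)

lemma (in cring) pair_sum_closed: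
  assumes "set ps \<subseteq> carrier R \<times> B" "\<rho> \<in> B \<rightarrow> carrier R"
  shows "pair_sum R \<rho> ps \<in> carrier R"
  using assms by (induction ps) (auto simp: Pi_iff)

lemma (in cring) pair_sum_append:
  assumes "set ps \<subseteq> carrier R \<times> B" "set qs \<subseteq> carrier R \<times> B" "\<rho> \<in> B \<rightarrow> carrier R"
  shows "pair_sum R \<rho> (ps @ qs) = pair_sum R \<rho> ps \<oplus> pair_sum R \<rho> qs"
  using assms(1)
  by (induction ps) (use assms(2,3) in \<open>auto simp: a_assoc pair_sum_closed[OF _ assms(3)] Pi_iff\<close>)

text \<open>
  One step of Gaussian elimination, with pivot \<open>G\<close>, where \<open>d\<close> is later the inverse of \<open>e G\<close>. The
  error is a multiple of the relation given by \<open>e\<close>.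
\<close>

lemma pair_sum_eliminate:
  assumes "cring A" "cring B" "cring L" "\<kappa> \<in> ring_hom L B" "\<rho> \<in> ring_hom B A"
    and "e \<in> ring_hom B L" "d \<in> carrier L" "G \<in> carrier B"
    and "set ps \<subseteq> carrier A \<times> carrier B"
  shows "pair_sum A \<rho> (map (\<lambda>(E', G'). (E', G' \<ominus>\<^bsub>B\<^esub> \<kappa> (d \<otimes>\<^bsub>L\<^esub> e G') \<otimes>\<^bsub>B\<^esub> G)) ps)
    = pair_sum A \<rho> ps \<ominus>\<^bsub>A\<^esub>
      \<rho> G \<otimes>\<^bsub>A\<^esub> \<rho> (\<kappa> d) \<otimes>\<^bsub>A\<^esub> pair_sum A (\<lambda>G'. \<rho> (\<kappa> (e G'))) ps"
  using assms(9)
proof (induction ps)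
  interpret A: cring A by fact
  interpret B: cring B by fact
  interpret L: cring L by fact
  interpret k: ring_hom_cring L B \<kappa> by unfold_locales fact
  interpret r: ring_hom_cring B A \<rho> by unfold_locales fact
  interpret e: ring_hom_cring B L e by unfold_locales fact
  {
    case Nil
    have "\<rho> G \<otimes>\<^bsub>A\<^esub> \<rho> (\<kappa> d) \<otimes>\<^bsub>A\<^esub> \<zero>\<^bsub>A\<^esub> = \<zero>\<^bsub>A\<^esub>" using assms(7,8) by simp
    then show ?case by (simp add: a_minus_def)
  next
    case (Cons p ps)
    obtain E' G' where p: "p = (E', G')" by fastforce
    have G': "E' \<in> carrier A" "G' \<in> carrier B" "set ps \<subseteq> carrier A \<times> carrier B"
      using Cons.prems p by auto
    define s where "s = pair_sum A \<rho> ps"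
    define t where "t = pair_sum A (\<lambda>G'. \<rho> (\<kappa> (e G'))) ps"
    have st: "s \<in> carrier A" "t \<in> carrier A"
      using G' by (auto simp: s_def t_def intro!: A.pair_sum_closed[where B = "carrier B"])
    \<comment> \<open>Naming the images leaves a plain identity between elements of the commutative
      ring \<open>A\<close>.\<close>
    define g g' c c' where "g = \<rho> G" and "g' = \<rho> G'" and "c = \<rho> (\<kappa> d)" and "c' = \<rho> (\<kappa> (e G'))"
    have cl: "g \<in> carrier A" "g' \<in> carrier A" "c \<in> carrier A" "c' \<in> carrier A"
      using G' assms(7,8) by (simp_all add: g_def g'_def c_def c'_def)
    have "E' \<otimes>\<^bsub>A\<^esub> (g' \<ominus>\<^bsub>A\<^esub> c \<otimes>\<^bsub>A\<^esub> c' \<otimes>\<^bsub>A\<^esub> g) \<oplus>\<^bsub>A\<^esub> (s \<ominus>\<^bsub>A\<^esub> g \<otimes>\<^bsub>A\<^esub> c \<otimes>\<^bsub>A\<^esub> t)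
        = (E' \<otimes>\<^bsub>A\<^esub> g' \<oplus>\<^bsub>A\<^esub> s) \<ominus>\<^bsub>A\<^esub> g \<otimes>\<^bsub>A\<^esub> c \<otimes>\<^bsub>A\<^esub> (E' \<otimes>\<^bsub>A\<^esub> c' \<oplus>\<^bsub>A\<^esub> t)"
      using cl st G'(1) by algebra
    then show ?case using Cons.IH[OF G'(3)] G' assms(7,8)
      by (simp add: p s_def t_def g_def g'_def c_def c'_def)
  }
qed

text \<open>Induction on the number of pairs, removing one pivot at a time by relations that lie in
  \<open>q\<close>. In the application \<open>e i\<close> evaluates at the \<open>i\<close>-th
  point, \<open>\<kappa>\<close> embeds constants and \<open>q\<close> is the ideal of the infinite
  product point: membership of almost all specialisations of the last block is lifted to the last
  block itself.\<close>

lemma pair_sum_mem_of_eventually: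
  fixes U :: "'i filter"
  assumes "cring A" "cring B" "field L" "\<kappa> \<in> ring_hom L B" "\<rho> \<in> ring_hom B A"
    and e: "\<And>i. e i \<in> ring_hom B L" and e_const: "\<And>i c. c \<in> carrier L \<Longrightarrow> e i (\<kappa> c) = c"
    and q: "ideal q A"
    and U: "\<And>P. eventually P U \<or> eventually (\<lambda>i. \<not> P i) U" "U \<noteq> bot"
    and y: "\<And>G. G \<in> carrier B \<Longrightarrow> eventually (\<lambda>i. e i G = \<zero>\<^bsub>L\<^esub>) U \<Longrightarrow> \<rho> G \<in> q"
    and "set ps \<subseteq> carrier A \<times> carrier B"
    and "eventually (\<lambda>i. pair_sum A (\<lambda>G. \<rho> (\<kappa> (e i G))) ps \<in> q) U"
  shows "pair_sum A \<rho> ps \<in> q"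
  using assms(12-)
proof (induction "length ps" arbitrary: ps)
  case 0
  then show ?case using q by (simp add: additive_subgroup.zero_closed ideal.axioms(1))
next
  case (Suc l)
  interpret A: cring A by fact
  interpret B: cring B by fact
  interpret L: field L by fact
  interpret k: ring_hom_cring L B \<kappa> by unfold_locales fact
  interpret r: ring_hom_cring B A \<rho> by unfold_locales fact
  interpret e: ring_hom_cring B L "e i" for i by unfold_locales (rule e)
  interpret q: ideal q A by fact
  obtain E G ps' where ps: "ps = (E, G) # ps'" "length ps' = l"
    using Suc.hyps(2) by (metis length_Suc_conv surj_pair)
  have EG: "E \<in> carrier A" "G \<in> carrier B" "set ps' \<subseteq> carrier A \<times> carrier B"
    using Suc.prems(1) ps by auto
  let ?e = "\<lambda>i G. \<rho> (\<kappa> (e i G))"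
  have e_cl: "?e i \<in> carrier B \<rightarrow> carrier A" for i by auto
  show ?case
  proof (cases "eventually (\<lambda>i. e i G = \<zero>\<^bsub>L\<^esub>) U")
    case True
    have "eventually (\<lambda>i. pair_sum A (?e i) ps' \<in> q) U"
      using Suc.prems(2) True
    proof eventually_elim
      case (elim i)
      then show ?case using EG A.pair_sum_closed[OF EG(3) e_cl] by (simp add: ps)
    qed
    then have "pair_sum A \<rho> ps' \<in> q" using Suc.hyps(1) ps EG by blast
    moreover have "E \<otimes>\<^bsub>A\<^esub> \<rho> G \<in> q" using y[OF EG(2) True] EG by (simp add: q.I_l_closed)
    ultimately show ?thesis by (simp add: ps)
  next
    case False
    then have "eventually (\<lambda>i. e i G \<noteq> \<zero>\<^bsub>L\<^esub>) U" using U(1) by blast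
    \<comment> \<open>One index \<open>i\<^sub>0\<close> must give both an invertible pivot value
      and a relation in \<open>q\<close>. Both hold almost everywhere, and \<open>U\<close> is
      proper.\<close>
    from eventually_happens'[OF U(2) eventually_conj[OF this Suc.prems(2)]]
    obtain i\<^sub>0 where i: "e i\<^sub>0 G \<noteq> \<zero>\<^bsub>L\<^esub>" "pair_sum A (?e i\<^sub>0) ps \<in> q" by blast
    define d where "d = inv\<^bsub>L\<^esub> (e i\<^sub>0 G)"
    have d: "d \<in> carrier L" "d \<otimes>\<^bsub>L\<^esub> e i\<^sub>0 G = \<one>\<^bsub>L\<^esub>"
      using i(1) EG(2) by (simp_all add: d_def L.field_Units)
    define f where "f = (\<lambda>(E' :: 'a, G'). (E', G' \<ominus>\<^bsub>B\<^esub> \<kappa> (d \<otimes>\<^bsub>L\<^esub> e i\<^sub>0 G') \<otimes>\<^bsub>B\<^esub> G))"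
    have f_cl: "set (map f ps') \<subseteq> carrier A \<times> carrier B"
      using EG d(1) by (force simp: f_def)
    \<comment> \<open>The elimination is carried out for a general \<open>\<sigma>\<close> because
      it is needed for \<open>\<rho>\<close> and for every specialisation \<open>?e i\<close>; all
      of these agree on constants.\<close>
    have gauss: "pair_sum A \<sigma> (map f ps')
        = pair_sum A \<sigma> ps \<ominus>\<^bsub>A\<^esub> \<sigma> G \<otimes>\<^bsub>A\<^esub> \<rho> (\<kappa> d) \<otimes>\<^bsub>A\<^esub> pair_sum A (?e i\<^sub>0) ps"
      if s: "\<sigma> \<in> ring_hom B A" "\<And>c. c \<in> carrier L \<Longrightarrow> \<sigma> (\<kappa> c) = \<rho> (\<kappa> c)" for \<sigma>
    proof -
      interpret s: ring_hom_cring B A \<sigma> by unfold_locales fact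
      have "pair_sum A (\<lambda>G. \<sigma> (\<kappa> (e i\<^sub>0 G))) qs = pair_sum A (?e i\<^sub>0) qs"
        if "set qs \<subseteq> carrier A \<times> carrier B" for qs
        using that by (induction qs) (auto simp: s(2))
      note * = this[OF EG(3)]
      \<comment> \<open>The pivot itself becomes zero, since \<open>d\<close> inverts its value at
        \<open>i\<^sub>0\<close>. The list thus loses its head and the induction hypothesis
        applies.\<close>
      have "f (E, G) = (E, \<zero>\<^bsub>B\<^esub>)"
        using d EG(2) by (simp add: f_def a_minus_def B.r_neg)
      then have "pair_sum A \<sigma> (map f ps') = pair_sum A \<sigma> (map f ps)"
        using EG(1) A.pair_sum_closed[OF f_cl, of \<sigma>] by (simp add: ps(1))
      also have "\<dots> = pair_sum A \<sigma> ps \<ominus>\<^bsub>A\<^esub>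
          \<sigma> G \<otimes>\<^bsub>A\<^esub> \<sigma> (\<kappa> d) \<otimes>\<^bsub>A\<^esub> pair_sum A (\<lambda>G. \<sigma> (\<kappa> (e i\<^sub>0 G))) ps"
        unfolding f_def using Suc.prems(1) EG(2) d(1) assms(1-4) s(1) e L.is_cring
        by (intro pair_sum_eliminate) auto
      finally show ?thesis using d(1) * EG(2) by (simp add: s(2) ps)
    qed
    have mult: "c \<in> carrier A \<Longrightarrow> c \<otimes>\<^bsub>A\<^esub> \<rho> (\<kappa> d) \<otimes>\<^bsub>A\<^esub> pair_sum A (?e i\<^sub>0) ps \<in> q" for c
      using i(2) d(1) by (intro q.I_l_closed) auto
    have "eventually (\<lambda>i. pair_sum A (?e i) (map f ps') \<in> q) U"
      using Suc.prems(2)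
    proof eventually_elim
      case (elim i)
      have "?e i \<in> ring_hom B A"
        by (rule ring_hom_memI) (simp_all)
      then have "pair_sum A (?e i) (map f ps')
          = pair_sum A (?e i) ps \<ominus>\<^bsub>A\<^esub> ?e i G \<otimes>\<^bsub>A\<^esub> \<rho> (\<kappa> d) \<otimes>\<^bsub>A\<^esub> pair_sum A (?e i\<^sub>0) ps"
        by (intro gauss) (simp_all add: e_const)
      moreover have "?e i G \<otimes>\<^bsub>A\<^esub> \<rho> (\<kappa> d) \<otimes>\<^bsub>A\<^esub> pair_sum A (?e i\<^sub>0) ps \<in> q"
        using EG by (intro mult) auto
      ultimately show ?case using elim by (simp add: a_minus_def)
    qed
    then have "pair_sum A \<rho> (map f ps') \<in> q"
      using Suc.hyps(1)[of "map f ps'"] f_cl ps(2) by simp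
    then have "pair_sum A \<rho> ps \<ominus>\<^bsub>A\<^esub> \<rho> G \<otimes>\<^bsub>A\<^esub> \<rho> (\<kappa> d) \<otimes>\<^bsub>A\<^esub> pair_sum A (?e i\<^sub>0) ps \<in> q"
      using gauss[of \<rho>] assms(5) by simp
    then show ?thesis
    proof (rule q.mem_of_minus_mem)
      show "\<rho> G \<otimes>\<^bsub>A\<^esub> \<rho> (\<kappa> d) \<otimes>\<^bsub>A\<^esub> pair_sum A (?e i\<^sub>0) ps \<in> q"
        using mult EG(2) by simp
      show "pair_sum A \<rho> ps \<in> carrier A"
        by (rule A.pair_sum_closed[OF Suc.prems(1)]) simp
    qed
  qed
qed

lemma pair_sum_hom_cong:
  assumes "cring A" "cring S" "\<phi> \<in> ring_hom A S" "set ps \<subseteq> carrier A \<times> B"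
    "\<rho> \<in> B \<rightarrow> carrier A" "\<rho>' \<in> B \<rightarrow> carrier A" "\<And>G. G \<in> B \<Longrightarrow> \<phi> (\<rho> G) = \<phi> (\<rho>' G)"
  shows "\<phi> (pair_sum A \<rho> ps) = \<phi> (pair_sum A \<rho>' ps)"
proof -
  interpret A: cring A by fact
  interpret S: cring S by fact
  interpret ring_hom_cring A S \<phi> by unfold_locales fact
  show ?thesis using assms(4)
  proof (induction ps)
    case (Cons p ps)
    obtain E G where p: "p = (E, G)" by fastforce
    have "E \<in> carrier A" "G \<in> B" "set ps \<subseteq> carrier A \<times> B" "\<rho> G \<in> carrier A" "\<rho>' G \<in> carrier A"
      using Cons.prems p assms(5,6) by auto
    moreover have "pair_sum A \<rho> ps \<in> carrier A" "pair_sum A \<rho>' ps \<in> carrier A"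
      using A.pair_sum_closed calculation(3) assms(5,6) by blast+
    ultimately show ?case using Cons.IH assms(7) p by simp
  qed simp
qed

section \<open>Iterated quantification along the ultrafilter\<close>

text \<open>
  A function \<open>a\<close> assigns to each block of variables the index of a point. The quantifier for
  block \<open>m - 1\<close> is outermost, and the values of \<open>a\<close> from \<open>m\<close> on are kept.
\<close>

primrec iter_eventually ::
    "nat filter \<Rightarrow> nat \<Rightarrow> ((nat \<Rightarrow> nat) \<Rightarrow> bool) \<Rightarrow> (nat \<Rightarrow> nat) \<Rightarrow> bool" where
  "iter_eventually U 0 \<Phi> a = \<Phi> a"
| "iter_eventually U (Suc m) \<Phi> a = eventually (\<lambda>i. iter_eventually U m \<Phi> (a(m := i))) U"

text \<open>The iteration overwrites \<open>a\<close> only below \<open>m\<close>, so the predicates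
  have to agree only on functions that keep the later values.\<close>

lemma iter_eventually_cong:
  assumes "\<And>b. (\<And>i. i \<ge> m \<Longrightarrow> b i = a i) \<Longrightarrow> \<Phi> b = \<Psi> b"
  shows "iter_eventually U m \<Phi> a = iter_eventually U m \<Psi> a"
  using assms
proof (induction m arbitrary: a)
  case (Suc m)
  have "iter_eventually U m \<Phi> (a(m := i)) = iter_eventually U m \<Psi> (a(m := i))" for i
    using Suc.prems by (intro Suc.IH) auto
  then show ?case by simp
qed simp

lemma iter_eventually_mono:
  assumes "\<And>b. \<Phi> b \<Longrightarrow> \<Psi> b" "iter_eventually U m \<Phi> a"
  shows "iter_eventually U m \<Psi> a"
  using assms(2)
proof (induction m arbitrary: a)
  case (Suc m)
  from Suc.prems show ?case by (auto elim!: eventually_mono intro: Suc.IH)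
qed (simp add: assms(1))

lemma iter_eventually_conj:
  assumes "iter_eventually U m \<Phi> a" "iter_eventually U m \<Psi> a"
  shows "iter_eventually U m (\<lambda>b. \<Phi> b \<and> \<Psi> b) a"
  using assms
proof (induction m arbitrary: a)
  case (Suc m)
  from eventually_conj[OF Suc.prems[simplified]] show ?case
    by (auto elim!: eventually_mono intro: Suc.IH)
qed simp

lemma iter_eventually_False: "U \<noteq> bot \<Longrightarrow> \<not> iter_eventually U m (\<lambda>_. False) a"
  by (induction m arbitrary: a) auto

text \<open>At each stage only finitely many indices have been used, and \<open>U\<close> lies below
  \<open>cofinite\<close>, so almost every new index is fresh. \<open>M\<close> stays fixed while
  \<open>m\<close> decreases: the entries from \<open>m\<close> up to \<open>M\<close> are the
  indices chosen so far.\<close>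

lemma iter_eventually_inj:
  assumes "U \<le> cofinite" "m \<le> M" "inj_on a {m..<M}"
    and "\<And>b. (\<And>i. i \<ge> m \<Longrightarrow> b i = a i) \<Longrightarrow> inj_on b {..<M} \<Longrightarrow> \<Phi> b"
  shows "iter_eventually U m \<Phi> a"
  using assms(2-)
proof (induction m arbitrary: a)
  case 0
  then show ?case by (simp add: lessThan_atLeast0)
next
  case (Suc m)
  have "eventually (\<lambda>i. i \<notin> a ` {Suc m..<M}) U"
    using assms(1) by (rule filter_leD) (simp add: eventually_cofinite)
  then show ?case unfolding iter_eventually.simps
  proof eventually_elim
    case (elim i)
    have "inj_on (a(m := i)) {m..<M}"
    proof -
      have "{m..<M} = insert m {Suc m..<M}" using Suc.prems(1) by auto
      then show ?thesis using Suc.prems(2) elim by (auto simp: inj_on_def)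
    qed
    then show ?case
    proof (rule Suc.IH[rotated])
      show "m \<le> M" using Suc.prems(1) by simp
      fix b assume "\<And>j. m \<le> j \<Longrightarrow> b j = (a(m := i)) j" and inj: "inj_on b {..<M}"
      then have "b j = a j" if "Suc m \<le> j" for j using that by fastforce
      then show "\<Phi> b" using inj by (rule Suc.prems(3))
    qed
  qed
qed

section \<open>Ideals of elements vanishing along the ultrafilter\<close>

text \<open>This is the kernel of the map from \<open>B\<close> to the ultrapower of
  \<open>L\<close>, which has no zero divisors because \<open>U\<close> decides every
  predicate.\<close>

lemma eventually_zero_primeideal:
  assumes "cring B" "domain L" and e: "\<And>i. e i \<in> ring_hom B L"
    and U: "\<And>P. eventually P U \<or> eventually (\<lambda>i. \<not> P i) U" "U \<noteq> bot"
  shows "primeideal {G \<in> carrier B. eventually (\<lambda>i. e i G = \<zero>\<^bsub>L\<^esub>) U} B"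
proof -
  interpret B: cring B by fact
  interpret L: domain L by fact
  interpret e: ring_hom_cring B L "e i" for i by unfold_locales (rule e)
  let ?y = "{G \<in> carrier B. eventually (\<lambda>i. e i G = \<zero>\<^bsub>L\<^esub>) U}"
  have "ideal ?y B"
  proof (rule idealI)
    show "subgroup ?y (add_monoid B)"
    proof (rule B.add.subgroupI)
      fix G assume "G \<in> ?y"
      then show "\<ominus>\<^bsub>B\<^esub> G \<in> ?y" by (auto elim!: eventually_mono)
    next
      fix G H assume "G \<in> ?y" "H \<in> ?y"
      then have ev: "eventually (\<lambda>i. e i G = \<zero>\<^bsub>L\<^esub>) U" "eventually (\<lambda>i. e i H = \<zero>\<^bsub>L\<^esub>) U"
        and GH: "G \<in> carrier B" "H \<in> carrier B" by auto
      from ev have "eventually (\<lambda>i. e i (G \<oplus>\<^bsub>B\<^esub> H) = \<zero>\<^bsub>L\<^esub>) U"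
        by eventually_elim (simp add: GH)
      then show "G \<oplus>\<^bsub>B\<^esub> H \<in> ?y" using GH by simp
    qed (auto intro!: exI[of _ "\<zero>\<^bsub>B\<^esub>"])
  next
    fix G H assume "G \<in> ?y" "H \<in> carrier B"
    then show "H \<otimes>\<^bsub>B\<^esub> G \<in> ?y" "G \<otimes>\<^bsub>B\<^esub> H \<in> ?y"
      by (auto elim!: eventually_mono)
  qed (rule B.ring_axioms)
  moreover have "carrier B \<noteq> ?y"
  proof
    assume "carrier B = ?y"
    then have "\<one>\<^bsub>B\<^esub> \<in> ?y" using B.one_closed by metis
    then show False using U(2) by simp
  qed
  moreover have "G \<in> ?y \<or> H \<in> ?y"
    if "G \<in> carrier B" "H \<in> carrier B" "G \<otimes>\<^bsub>B\<^esub> H \<in> ?y" for G H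
  proof (rule disjCI)
    assume "H \<notin> ?y"
    then have "eventually (\<lambda>i. e i H \<noteq> \<zero>\<^bsub>L\<^esub>) U" using U(1) that(2) by auto
    moreover have "eventually (\<lambda>i. e i (G \<otimes>\<^bsub>B\<^esub> H) = \<zero>\<^bsub>L\<^esub>) U" using that(3) by simp
    ultimately have "eventually (\<lambda>i. e i G = \<zero>\<^bsub>L\<^esub>) U"
      by eventually_elim (use that(1,2) L.integral in auto)
    then show "G \<in> ?y" using that(1) by simp
  qed
  ultimately show ?thesis
    by (intro primeidealI) (auto simp: B.is_cring)
qed

text \<open>Different elements involve different numbers of blocks; the threshold \<open>M\<close>
  lets two of them be compared at a common \<open>m\<close>, where the conditions can be
  conjoined.\<close>

lemma iter_eventually_zero_ideal:
  assumes "cring A" "cring L" and \<phi>: "\<And>b. \<phi> b \<in> ring_hom A L"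
  shows "ideal {F \<in> carrier A. \<exists>M. \<forall>m \<ge> M. \<forall>a. iter_eventually U m (\<lambda>b. \<phi> b F = \<zero>\<^bsub>L\<^esub>) a} A"
    (is "ideal ?Z A")
proof -
  interpret A: cring A by fact
  interpret L: cring L by fact
  interpret e: ring_hom_cring A L "\<phi> b" for b by unfold_locales (rule \<phi>)
  have mono: "F' \<in> ?Z" if "F' \<in> carrier A" "F \<in> ?Z" "\<And>b. \<phi> b F = \<zero>\<^bsub>L\<^esub> \<Longrightarrow> \<phi> b F' = \<zero>\<^bsub>L\<^esub>" for F F'
  proof -
    obtain M where M: "\<forall>m \<ge> M. \<forall>a. iter_eventually U m (\<lambda>b. \<phi> b F = \<zero>\<^bsub>L\<^esub>) a"
      using \<open>F \<in> ?Z\<close> by auto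
    have "iter_eventually U m (\<lambda>b. \<phi> b F' = \<zero>\<^bsub>L\<^esub>) a" if "m \<ge> M" for m a
      using M that by (intro iter_eventually_mono[OF \<open>\<And>b. \<phi> b F = \<zero>\<^bsub>L\<^esub> \<Longrightarrow> \<phi> b F' = \<zero>\<^bsub>L\<^esub>\<close>]) auto
    then show ?thesis using \<open>F' \<in> carrier A\<close> by auto
  qed
  have "iter_eventually U m (\<lambda>_. True) a" for m a
    by (induction m arbitrary: a) simp_all
  then have zero: "\<zero>\<^bsub>A\<^esub> \<in> ?Z" by (auto intro!: exI[of _ 0])
  show ?thesis
  proof (rule idealI)
    show "subgroup ?Z (add_monoid A)"
    proof (rule A.add.subgroupI)
      fix F assume F: "F \<in> ?Z"
      show "\<ominus>\<^bsub>A\<^esub> F \<in> ?Z" by (rule mono[OF _ F]) (use F in auto)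
    next
      fix F G assume FG: "F \<in> ?Z" "G \<in> ?Z"
      then obtain M N where
        "\<forall>m \<ge> M. \<forall>a. iter_eventually U m (\<lambda>b. \<phi> b F = \<zero>\<^bsub>L\<^esub>) a"
        "\<forall>m \<ge> N. \<forall>a. iter_eventually U m (\<lambda>b. \<phi> b G = \<zero>\<^bsub>L\<^esub>) a" by blast
      then have MN:
        "\<And>m a. m \<ge> M \<Longrightarrow> iter_eventually U m (\<lambda>b. \<phi> b F = \<zero>\<^bsub>L\<^esub>) a"
        "\<And>m a. m \<ge> N \<Longrightarrow> iter_eventually U m (\<lambda>b. \<phi> b G = \<zero>\<^bsub>L\<^esub>) a" by blast+
      have "iter_eventually U m (\<lambda>b. \<phi> b (F \<oplus>\<^bsub>A\<^esub> G) = \<zero>\<^bsub>L\<^esub>) a" if "m \<ge> max M N" for m a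
        using that FG
        by (intro iter_eventually_mono[OF _ iter_eventually_conj[OF MN(1,2)]]) auto
      then have "\<exists>M. \<forall>m \<ge> M. \<forall>a. iter_eventually U m (\<lambda>b. \<phi> b (F \<oplus>\<^bsub>A\<^esub> G) = \<zero>\<^bsub>L\<^esub>) a"
        by (intro exI[of _ "max M N"]) auto
      then show "F \<oplus>\<^bsub>A\<^esub> G \<in> ?Z" using FG by simp
    next
      show "?Z \<noteq> {}" using zero by blast
    qed auto
  next
    fix F G assume F: "F \<in> ?Z" "G \<in> carrier A"
    show "G \<otimes>\<^bsub>A\<^esub> F \<in> ?Z" by (rule mono[OF _ F(1)]) (use F in auto)
    show "F \<otimes>\<^bsub>A\<^esub> G \<in> ?Z" by (rule mono[OF _ F(1)]) (use F in auto)
  qed (rule A.ring_axioms)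
qed

section \<open>Polynomials in finitely many blocks of variables\<close>

lemma (in cring) indexed_pset_bounded:
  assumes "F \<in> indexed_pset (UNIV \<times> J) (carrier R)"
  obtains m :: nat where "F \<in> indexed_pset ({..<m} \<times> J) (carrier R)"
proof -
  have "\<exists>m :: nat. F \<in> indexed_pset ({..<m} \<times> J) (carrier R)"
    using assms
  proof induction
    case (indexed_const k)
    then show ?case by (auto intro: indexed_pset.intros)
  next
    case (indexed_padd P Q)
    then obtain m m' where m: "P \<in> indexed_pset ({..<m} \<times> J) (carrier R)"
      "Q \<in> indexed_pset ({..<m'} \<times> J) (carrier R)" by auto
    have "P \<in> indexed_pset ({..<max m m'} \<times> J) (carrier R)"
      by (rule indexed_pset_mono[OF _ m(1)]) auto
    moreover have "Q \<in> indexed_pset ({..<max m m'} \<times> J) (carrier R)"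
      by (rule indexed_pset_mono[OF _ m(2)]) auto
    ultimately show ?case by (blast intro: indexed_pset.intros)
  next
    case (indexed_pmult P v)
    then obtain m where m: "P \<in> indexed_pset ({..<m} \<times> J) (carrier R)" by auto
    have "P \<in> indexed_pset ({..<max m (Suc (fst v))} \<times> J) (carrier R)"
      by (rule indexed_pset_mono[OF _ m]) auto
    moreover have "v \<in> {..<max m (Suc (fst v))} \<times> J"
      using indexed_pmult.hyps(2) by (cases v) auto
    ultimately show ?case by (blast intro: indexed_pset.intros)
  qed
  then show thesis using that by blast
qed

text \<open>Induction on \<open>F\<close>: a constant is paired with one, a sum concatenates the
  lists, and a variable is absorbed into every \<open>E\<close> if its block lies before
  \<open>m\<close>, otherwise into every \<open>G\<close>.\<close>

lemma (in cring) indexed_pset_last_block: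
  fixes J :: "'j set"
  assumes "F \<in> indexed_pset ({..<Suc m} \<times> J) (carrier R)"
  obtains ps where "set ps \<subseteq> indexed_pset ({..<m} \<times> J) (carrier R) \<times> indexed_pset J (carrier R)"
    and "F = pair_sum (mpoly_ring R (UNIV \<times> J)) (mpoly_rename R (Pair m)) ps"
proof -
  let ?D = "indexed_pset ({..<m} \<times> J) (carrier R) \<times> indexed_pset J (carrier R)"
  let ?A = "mpoly_ring R ((UNIV :: nat set) \<times> J)" and ?\<rho> = "mpoly_rename R (Pair m)"
  interpret A: cring ?A by (rule mpoly_ring_cring)
  have mono: "P \<in> indexed_pset ({..<m} \<times> J) (carrier R) \<Longrightarrow> P \<in> carrier ?A" for P
    by (simp add: mpoly_ring_simps) (erule indexed_pset_mono[rotated], auto)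
  have \<rho>: "?\<rho> G \<in> carrier ?A" if "G \<in> indexed_pset J (carrier R)" for G
    using that by (simp add: mpoly_ring_simps) (erule mpoly_rename_closed, auto)
  note c = carrier_coeff_psetD
  have cl: "pair_sum ?A ?\<rho> ps \<in> carrier ?A" if "set ps \<subseteq> ?D" for ps
    using that mono \<rho> by (intro A.pair_sum_closed[where B = "indexed_pset J (carrier R)"]) auto
  have pmult: "indexed_pmult (pair_sum ?A ?\<rho> ps) (i, j)
      = pair_sum ?A ?\<rho> (map (\<lambda>(E, G). if i < m then (indexed_pmult E (i, j), G) else (E, indexed_pmult G j)) ps)"
    if "set ps \<subseteq> ?D" "i < Suc m" "j \<in> J" for ps i j
    using that(1)
  proof (induction ps)
    case Nil
    then show ?case by (simp add: mpoly_ring_simps)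
  next
    case (Cons p ps)
    obtain E G where p: "p = (E, G)" by fastforce
    have EG: "E \<in> carrier ?A" "E \<in> indexed_pset ({..<m} \<times> J) (carrier R)"
      "G \<in> indexed_pset J (carrier R)" "?\<rho> G \<in> carrier ?A" "set ps \<subseteq> ?D"
      using Cons.prems p mono \<rho> by auto
    have co: "carrier_coeff E" "carrier_coeff (?\<rho> G)" "carrier_coeff G"
      using EG by (auto simp: mpoly_ring_simps intro: c)
    have "indexed_pmult (mpoly_mult R E (?\<rho> G)) (i, j)
        = (if i < m then mpoly_mult R (indexed_pmult E (i, j)) (?\<rho> G)
           else mpoly_mult R E (?\<rho> (indexed_pmult G j)))"
    proof (cases "i < m")
      case True
      then show ?thesis using co
        by (simp add: mpoly_mult_comm[of _ "?\<rho> G"] indexed_pmult_in_carrier mpoly_mult_pmult)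
    next
      case False
      then have "i = m" using that(2) by simp
      then show ?thesis using co by (simp add: mpoly_mult_pmult mpoly_rename_pmult)
    qed
    moreover have "indexed_pmult (indexed_padd P Q) v = indexed_padd (indexed_pmult P v) (indexed_pmult Q v)"
      for P Q :: "(nat \<times> 'j) multiset \<Rightarrow> 'a" and v
      by (auto simp: indexed_pmult_def indexed_padd_def)
    ultimately show ?case using Cons.IH[OF EG(5)] by (simp add: p mpoly_ring_simps)
  qed
  have "\<exists>ps. set ps \<subseteq> ?D \<and> F = pair_sum ?A ?\<rho> ps"
    using assms
  proof induction
    case (indexed_const k)
    have "indexed_const k = pair_sum ?A ?\<rho> [(indexed_const k, indexed_const \<one>)]"
      using indexed_const A.r_one[of "indexed_const k"] A.r_zero[of "indexed_const k"]
      by (simp add: mpoly_rename_const mpoly_ring_simps indexed_pset.intros)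
    then show ?case using indexed_const
      by (intro exI[of _ "[(indexed_const k, indexed_const \<one>)]"]) (auto intro: indexed_pset.intros)
  next
    case (indexed_padd P Q)
    then obtain ps qs where D: "set ps \<subseteq> ?D" "set qs \<subseteq> ?D"
      and PQ: "P = pair_sum ?A ?\<rho> ps" "Q = pair_sum ?A ?\<rho> qs" by auto
    have "?D \<subseteq> carrier ?A \<times> indexed_pset J (carrier R)" using mono by auto
    then have "pair_sum ?A ?\<rho> (ps @ qs) = indexed_padd P Q"
      unfolding PQ using D \<rho>
      by (subst A.pair_sum_append[where B = "indexed_pset J (carrier R)"])
        (auto simp: mpoly_ring_simps(5))
    then show ?case using D by (intro exI[of _ "ps @ qs"]) auto
  next
    case (indexed_pmult P v)
    then obtain ps where ps: "set ps \<subseteq> ?D" "P = pair_sum ?A ?\<rho> ps" by auto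
    obtain i j where v: "v = (i, j)" "i < Suc m" "j \<in> J" using indexed_pmult.hyps(2) by auto
    have "set (map (\<lambda>(E, G). if i < m then (indexed_pmult E (i, j), G) else (E, indexed_pmult G j)) ps) \<subseteq> ?D"
    proof clarify
      fix E' G' assume "(E', G') \<in> set (map (\<lambda>(E, G). if i < m then (indexed_pmult E (i, j), G) else (E, indexed_pmult G j)) ps)"
      then obtain E G where EG: "(E, G) \<in> set ps"
        "(E', G') = (if i < m then (indexed_pmult E (i, j), G) else (E, indexed_pmult G j))" by auto
      then have "E \<in> indexed_pset ({..<m} \<times> J) (carrier R)" "G \<in> indexed_pset J (carrier R)"
        using ps(1) by auto
      then show "E' \<in> indexed_pset ({..<m} \<times> J) (carrier R) \<and> G' \<in> indexed_pset J (carrier R)"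
        using EG(2) v(3) by (auto split: if_splits intro!: indexed_pset.indexed_pmult)
    qed
    then show ?case using pmult[OF ps(1) v(2,3)] ps(2) v(1) by blast
  qed
  then show thesis using that by blast
qed

text \<open>Inside a large enough interval the complements of the domain and of the image have the
  same size, so a bijection \<open>g\<close> between them completes \<open>b\<close>; beyond the
  interval the identity is used. This makes invariance under \<open>Sym_inf\<close> applicable to
  any injective choice of points.\<close>

lemma exists_Sym_inf_extension:
  assumes "inj_on b {..<m}"
  obtains \<sigma> where "\<sigma> \<in> Sym_inf" "\<And>i. i < m \<Longrightarrow> \<sigma> i = b i"
proof -
  have "finite (b ` {..<m})" by simp
  then obtain k\<^sub>0 where k\<^sub>0: "\<forall>i \<in> b ` {..<m}. i < k\<^sub>0" unfolding finite_nat_set_iff_bounded by blast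
  define k where "k = max k\<^sub>0 m"
  have k: "b i < k" if "i < m" for i using k\<^sub>0 that by (force simp: k_def less_max_iff_disj)
  have "m \<le> k" by (simp add: k_def)
  have sub: "{..<m} \<subseteq> {..<k}" "b ` {..<m} \<subseteq> {..<k}" using k \<open>m \<le> k\<close> by auto
  have "card ({..<k} - {..<m}) = card ({..<k} - b ` {..<m})"
    using sub assms by (simp add: card_Diff_subset card_image)
  then obtain g where g: "bij_betw g ({..<k} - {..<m}) ({..<k} - b ` {..<m})"
    using finite_same_card_bij[of "{..<k} - {..<m}" "{..<k} - b ` {..<m}"] by auto
  define \<sigma> where "\<sigma> i = (if i < m then b i else if i < k then g i else i)" for i
  have "bij_betw \<sigma> ({..<m} \<union> ({..<k} - {..<m})) (b ` {..<m} \<union> ({..<k} - b ` {..<m}))"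
  proof (rule bij_betw_combine)
    show "bij_betw \<sigma> {..<m} (b ` {..<m})"
    proof -
      have "bij_betw \<sigma> {..<m} (b ` {..<m}) \<longleftrightarrow> bij_betw b {..<m} (b ` {..<m})"
        by (rule bij_betw_cong) (simp add: \<sigma>_def)
      then show ?thesis using inj_on_imp_bij_betw[OF assms] by simp
    qed
    show "bij_betw \<sigma> ({..<k} - {..<m}) ({..<k} - b ` {..<m})"
    proof -
      have "bij_betw \<sigma> ({..<k} - {..<m}) ({..<k} - b ` {..<m})
          \<longleftrightarrow> bij_betw g ({..<k} - {..<m}) ({..<k} - b ` {..<m})"
        by (rule bij_betw_cong) (simp add: \<sigma>_def)
      then show ?thesis using g by simp
    qed
  qed auto
  then have "bij_betw \<sigma> {..<k} {..<k}" by (simp only: sub Diff_partition)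
  then have "\<sigma> permutes {..<k}"
    by (rule bij_imp_permutes) (use \<open>m \<le> k\<close> in \<open>auto simp: \<sigma>_def\<close>)
  then have "\<sigma> \<in> Sym_inf" by (auto simp: Sym_inf_def)
  then show thesis by (rule that) (simp add: \<sigma>_def)
qed

section \<open>Projections of product points\<close>

text \<open>The sequence of points is stored as one function: \<open>\<xi> (i, j)\<close> is the
  \<open>j\<close>-th coordinate of the \<open>i\<close>-th point.\<close>

locale point_sequence = field L for L (structure) +
  fixes n :: nat and \<xi> :: "nat \<times> nat \<Rightarrow> 'a" and U :: "nat filter"
  assumes \<xi>: "\<xi> \<in> UNIV \<rightarrow> carrier L"
    and ultra: "\<And>P. eventually P U \<or> eventually (\<lambda>i. \<not> P i) U"
    and U_bot: "U \<noteq> bot" and U_cofinite: "U \<le> cofinite"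
begin

definition block_eval :: "nat \<Rightarrow> (nat multiset \<Rightarrow> 'a) \<Rightarrow> 'a" where
  "block_eval i = mpoly_eval L (\<lambda>j. \<xi> (i, j))"

text \<open>The point \<open>y\<close> of the theorem.\<close>

definition limit_ideal :: "(nat multiset \<Rightarrow> 'a) set" where
  "limit_ideal = {G \<in> carrier (aff_ring L n). eventually (\<lambda>i. block_eval i G = \<zero>) U}"

definition choice_eval :: "(nat \<Rightarrow> nat) \<Rightarrow> ((nat \<times> nat) multiset \<Rightarrow> 'a) \<Rightarrow> 'a" where
  "choice_eval b = mpoly_eval L (\<lambda>(i, j). \<xi> (b i, j))"

lemma point_closed:
  "(\<lambda>j. \<xi> (i, j)) \<in> UNIV \<rightarrow> carrier L" "(\<lambda>(i, j). \<xi> (b i, j)) \<in> UNIV \<rightarrow> carrier L"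
  using \<xi> by auto

lemma block_eval_hom: "block_eval i \<in> ring_hom (mpoly_ring L I) L"
  unfolding block_eval_def by (rule mpoly_eval_hom[OF point_closed(1)])

lemma choice_eval_hom: "choice_eval b \<in> ring_hom (mpoly_ring L I) L"
  unfolding choice_eval_def by (rule mpoly_eval_hom[OF point_closed(2)])

lemma choice_eval_rename_block:
  assumes "G \<in> carrier (mpoly_ring L I)"
  shows "choice_eval b (mpoly_rename L (Pair m) G) = block_eval (b m) G"
  using assms
  by (simp add: choice_eval_def block_eval_def mpoly_ring_simps mpoly_eval_rename[OF _ point_closed(2)] o_def)

lemma choice_eval_const: "c \<in> carrier L \<Longrightarrow> choice_eval b (indexed_const c) = c"
  by (simp add: choice_eval_def mpoly_eval_const[OF point_closed(2)])

lemma aff_cring: "cring (aff_ring L n)" "cring (aff_inf_ring L n)"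
  by (simp_all add: aff_ring_def aff_inf_ring_def mpoly_ring_cring)

lemma limit_ideal_prime: "primeideal limit_ideal (aff_ring L n)"
  unfolding limit_ideal_def
  by (rule eventually_zero_primeideal[OF aff_cring(1) domain_axioms _ ultra U_bot])
    (simp add: aff_ring_def block_eval_hom)

lemma rename_block_hom: "mpoly_rename L (Pair i) \<in> ring_hom (aff_ring L n) (aff_inf_ring L n)"
  unfolding aff_ring_def aff_inf_ring_def by (rule mpoly_rename_hom) auto

lemma inf_point_generators:
  "{mpoly_rename L (\<lambda>j. (i, j)) f | i f. f \<in> limit_ideal} \<subseteq> carrier (aff_inf_ring L n)"
  using ring_hom_memE(1)[OF rename_block_hom] by (auto simp: limit_ideal_def)

lemma inf_point_ideal: "ideal (inf_point L n limit_ideal) (aff_inf_ring L n)"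
  unfolding inf_point_def
  by (rule ring.genideal_ideal[OF cring.axioms(1)[OF aff_cring(2)] inf_point_generators])

lemma rename_mem_inf_point: "f \<in> limit_ideal \<Longrightarrow> mpoly_rename L (Pair i) f \<in> inf_point L n limit_ideal"
  unfolding inf_point_def
  using ring.genideal_self[OF cring.axioms(1)[OF aff_cring(2)] inf_point_generators] by blast

text \<open>The condition on \<open>F\<close> describes an ideal, so only generators need checking.
  For a generator in block \<open>k\<close> only the quantifier for that block matters, and it is
  present as soon as \<open>m\<close> exceeds \<open>k\<close>.\<close>

lemma inf_point_imp_eventually:
  assumes "F \<in> inf_point L n limit_ideal"
  shows "\<exists>M. \<forall>m \<ge> M. \<forall>a. iter_eventually U m (\<lambda>b. choice_eval b F = \<zero>) a"
proof -
  let ?Z = "{F \<in> carrier (aff_inf_ring L n). \<exists>M. \<forall>m \<ge> M. \<forall>a. iter_eventually U m (\<lambda>b. choice_eval b F = \<zero>) a}"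
  have Z: "ideal ?Z (aff_inf_ring L n)"
    by (rule iter_eventually_zero_ideal[OF aff_cring(2) is_cring])
      (simp add: aff_inf_ring_def choice_eval_hom)
  have "mpoly_rename L (Pair k) G \<in> ?Z" if G: "G \<in> limit_ideal" for k G
  proof -
    have G': "G \<in> carrier (aff_ring L n)" "eventually (\<lambda>i. block_eval i G = \<zero>) U"
      using G by (simp_all add: limit_ideal_def)
    have "iter_eventually U m (\<lambda>b. block_eval (b k) G = \<zero>) a" if "m > k" for m a
      using that
    proof (induction m arbitrary: a)
      case (Suc m a)
      show ?case
      proof (cases "m = k")
        case True
        \<comment> \<open>The index of block \<open>k\<close> is chosen at this stage, and the inner
          stages keep it, so the predicate becomes constant.\<close>
        have "iter_eventually U k (\<lambda>b. block_eval (b k) G = \<zero>) (a(k := i))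
            = iter_eventually U k (\<lambda>b. block_eval i G = \<zero>) (a(k := i))" for i
          by (rule iter_eventually_cong) simp
        moreover have "iter_eventually U k (\<lambda>b. True) c" for c
          by (induction k arbitrary: c) simp_all
        ultimately show ?thesis using G'(2) True by (auto elim!: eventually_mono)
      next
        case False
        then show ?thesis using Suc by simp
      qed
    qed simp
    then show ?thesis
      using ring_hom_memE(1)[OF rename_block_hom G'(1)] G'(1) choice_eval_rename_block[of G "{1..n}"]
      by (auto simp: aff_ring_def intro!: exI[of _ "Suc k"])
  qed
  then have "inf_point L n limit_ideal \<subseteq> ?Z"
    unfolding inf_point_def
    by (intro ring.genideal_minimal[OF cring.axioms(1)[OF aff_cring(2)] Z]) auto
  then show ?thesis using assms by auto
qed

text \<open>Induction on the number of blocks. Specialising the last block to a point leaves a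
  polynomial in fewer blocks, still over \<open>L\<close>; the induction hypothesis puts it into the
  ideal for almost every point, and the elimination lemma recovers \<open>F\<close>.\<close>

lemma eventually_imp_inf_point:
  assumes "F \<in> indexed_pset ({..<m} \<times> {1..n}) (carrier L)"
    and "iter_eventually U m (\<lambda>b. choice_eval b F = \<zero>) a"
  shows "F \<in> inf_point L n limit_ideal"
  using assms
proof (induction m arbitrary: F a)
  case 0
  have "F \<in> indexed_pset {} (carrier L)" using "0.prems"(1) by simp
  then obtain c where c: "c \<in> carrier L" "F = indexed_const c"
  proof (induction arbitrary: thesis)
    case (indexed_padd P Q)
    from indexed_padd.IH(1) obtain c where "c \<in> carrier L" "P = indexed_const c" by blast
    moreover from indexed_padd.IH(2) obtain d where "d \<in> carrier L" "Q = indexed_const d" by blast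
    ultimately show ?case
      using indexed_padd.prems[of "c \<oplus> d"] by (simp add: indexed_padd_const)
  qed auto
  then have "F = indexed_const \<zero>"
    using "0.prems"(2) by (simp add: choice_eval_const)
  then show ?case using additive_subgroup.zero_closed[OF ideal.axioms(1)[OF inf_point_ideal]] by (simp add: aff_inf_ring_def mpoly_ring_simps)
next
  case (Suc m)
  let ?A = "aff_inf_ring L n" and ?B = "aff_ring L n"
  let ?I = "{..<m} \<times> {1..n}"
  \<comment> \<open>The smaller ring has the same operations as \<open>?A\<close> and records that
    the coefficients, hence also \<open>?T i\<close> below, use only the blocks before
    \<open>m\<close>.\<close>
  let ?A' = "mpoly_ring L ?I"
  interpret A: cring ?A by (rule aff_cring)
  interpret A': cring ?A' by (rule mpoly_ring_cring)
  have sub: "carrier ?A' \<subseteq> carrier ?A"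
    by (auto simp: aff_inf_ring_def mpoly_ring_simps intro: indexed_pset_mono[rotated])
  obtain ps where ps: "set ps \<subseteq> carrier ?A' \<times> carrier ?B"
    and F: "F = pair_sum ?A (mpoly_rename L (Pair m)) ps"
    using indexed_pset_last_block[OF Suc.prems(1)] unfolding aff_inf_ring_def aff_ring_def
    by (metis mpoly_ring_simps(1))
  have psA: "set ps \<subseteq> carrier ?A \<times> carrier ?B" using ps sub by auto
  have \<rho>: "mpoly_rename L (Pair m) \<in> carrier ?B \<rightarrow> carrier ?A"
    using ring_hom_memE(1)[OF rename_block_hom] by auto
  have e_cl: "block_eval i G \<in> carrier L" if "G \<in> carrier ?B" for i G
    using that ring_hom_memE(1)[OF block_eval_hom] by (simp add: aff_ring_def)
  have const: "mpoly_rename L (Pair m) (indexed_const (block_eval i G)) = indexed_const (block_eval i G)"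
    if "G \<in> carrier ?B" for i G
    using that by (simp add: e_cl mpoly_rename_const)
  \<comment> \<open>\<open>?T i\<close> is \<open>F\<close> with its last block specialised to the
    \<open>i\<close>-th point.\<close>
  let ?T = "\<lambda>i. pair_sum ?A (\<lambda>G. indexed_const (block_eval i G)) ps"
  have T: "?T i \<in> indexed_pset ?I (carrier L)" for i
  proof -
    have "pair_sum ?A' (\<lambda>G. indexed_const (block_eval i G)) ps \<in> carrier ?A'"
      using ps e_cl by (intro A'.pair_sum_closed[where B = "carrier ?B"])
        (auto simp: mpoly_ring_simps intro: indexed_pset.intros)
    then show ?thesis by (simp add: pair_sum_def aff_inf_ring_def mpoly_ring_simps)
  qed
  have "eventually (\<lambda>i. ?T i \<in> inf_point L n limit_ideal) U"
    using Suc.prems(2) unfolding iter_eventually.simps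
  proof eventually_elim
    case (elim i)
    have "choice_eval b F = choice_eval b (?T i)" if "b m = i" for b
      unfolding F
    proof (rule pair_sum_hom_cong[OF aff_cring(2) is_cring _ psA \<rho>])
      show "choice_eval b \<in> ring_hom ?A L" by (simp add: aff_inf_ring_def choice_eval_hom)
      show "(\<lambda>G. indexed_const (block_eval i G)) \<in> carrier ?B \<rightarrow> carrier ?A"
        using e_cl by (auto simp: aff_inf_ring_def mpoly_ring_simps intro: indexed_pset.intros)
      show "choice_eval b (mpoly_rename L (Pair m) G) = choice_eval b (indexed_const (block_eval i G))"
        if "G \<in> carrier ?B" for G
        using that \<open>b m = i\<close> e_cl choice_eval_rename_block[of G "{1..n}" b m]
        by (simp add: aff_ring_def choice_eval_const)
    qed
    then have "iter_eventually U m (\<lambda>b. choice_eval b F = \<zero>) (a(m := i))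
        = iter_eventually U m (\<lambda>b. choice_eval b (?T i) = \<zero>) (a(m := i))"
      by (intro iter_eventually_cong) simp
    then show ?case using elim Suc.IH[OF T] by blast
  qed
  \<comment> \<open>Renaming fixes constants, so \<open>?T i\<close> has the form of the specialised
    sums in \<open>pair_sum_mem_of_eventually\<close>.\<close>
  moreover have "?T i = pair_sum ?A (\<lambda>G. mpoly_rename L (Pair m) (indexed_const (block_eval i G))) ps" for i
    using psA by (induction ps) (auto simp: const)
  ultimately have ev: "eventually (\<lambda>i. pair_sum ?A
      (\<lambda>G. mpoly_rename L (Pair m) (indexed_const (block_eval i G))) ps \<in> inf_point L n limit_ideal) U"
    by simp
  show ?case unfolding F
  proof (rule pair_sum_mem_of_eventually[OF aff_cring(2,1) field_axioms _ rename_block_hom _ _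
        inf_point_ideal ultra U_bot _ psA ev])
    show "indexed_const \<in> ring_hom L ?B" by (simp add: aff_ring_def indexed_const_hom)
    show "block_eval i \<in> ring_hom ?B L" for i by (simp add: aff_ring_def block_eval_hom)
    show "block_eval i (indexed_const c) = c" if "c \<in> carrier L" for i c
      using that by (simp add: block_eval_def mpoly_eval_const[OF point_closed(1)])
    show "mpoly_rename L (Pair m) G \<in> inf_point L n limit_ideal"
      if "G \<in> carrier ?B" "eventually (\<lambda>i. block_eval i G = \<zero>) U" for G
      using that by (intro rename_mem_inf_point) (simp add: limit_ideal_def)
  qed
qed

end

section \<open>Invariant ideals as projections\<close>

text \<open>By invariance, a polynomial over \<open>K\<close> vanishes at all injective choices of
  points or at none. Almost all iterated choices are injective, so the ultrafilter criterion for
  \<open>inf_point\<close> becomes membership in \<open>x\<close>.\<close>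

lemma exchangeable_point_projection:
  assumes "cring K" "field L" and h: "h \<in> ring_hom K L"
    and \<xi>: "\<xi> \<in> UNIV \<rightarrow> carrier L"
    and x: "x = {f \<in> carrier (aff_inf_ring K n). mpoly_eval L \<xi> (h \<circ> f) = \<zero>\<^bsub>L\<^esub>}"
    and sym: "\<forall>\<sigma> \<in> Sym_inf. sym_act K \<sigma> ` x = x"
  shows "\<exists>y. primeideal y (aff_ring L n) \<and> x = proj_point K n h (inf_point L n y)"
proof -
  obtain U :: "nat filter" where U: "\<And>P. eventually P U \<or> eventually (\<lambda>i. \<not> P i) U" "U \<noteq> bot" "U \<le> cofinite"
    using exists_nonprincipal_ultrafilter by blast
  interpret K: cring K by fact
  interpret L: field L by fact
  interpret point_sequence L n \<xi> U
    by unfold_locales (fact \<xi> U)+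
  note cr = h K.is_cring L.is_cring
  have eval_act: "mpoly_eval L \<xi> (h \<circ> sym_act K \<sigma> f) = choice_eval \<sigma> (h \<circ> f)"
    if "f \<in> carrier (aff_inf_ring K n)" for f \<sigma>
  proof -
    have f: "f \<in> K.indexed_pset (UNIV \<times> {1..n}) (carrier K)"
      using that by (simp add: aff_inf_ring_def mpoly_ring_simps)
    show ?thesis
      unfolding sym_act_def mpoly_map_rename[OF cr f] choice_eval_def
      by (subst L.mpoly_eval_rename[OF mpoly_map_closed[OF cr f] \<xi>])
        (simp add: o_def case_prod_beta')
  qed
  have act_closed: "sym_act K \<sigma> f \<in> carrier (aff_inf_ring K n)" if "f \<in> carrier (aff_inf_ring K n)" for f \<sigma>
    using that unfolding sym_act_def aff_inf_ring_def mpoly_ring_simps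
    by (rule K.mpoly_rename_closed) auto
  have local: "choice_eval b F = choice_eval c F"
    if "F \<in> L.indexed_pset ({..<m} \<times> {1..n}) (carrier L)" "\<And>i. i < m \<Longrightarrow> b i = c i" for b c F m
    unfolding choice_eval_def
    by (rule L.mpoly_eval_cong[OF that(1) point_closed(2) point_closed(2)]) (auto simp: that(2))
  \<comment> \<open>Invariance moves a zero at the original sequence to every permuted sequence, and
    a permutation can match \<open>b\<close> on the blocks that occur in \<open>f\<close>.\<close>
  have zero: "choice_eval b (h \<circ> f) = \<zero>\<^bsub>L\<^esub>"
    if f: "f \<in> x" "h \<circ> f \<in> L.indexed_pset ({..<m} \<times> {1..n}) (carrier L)" and b: "inj_on b {..<m}" for f b m
  proof -
    obtain \<sigma> where \<sigma>: "\<sigma> \<in> Sym_inf" "\<And>i. i < m \<Longrightarrow> \<sigma> i = b i"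
      using exists_Sym_inf_extension[OF b] by blast
    have "sym_act K \<sigma> f \<in> x" using f(1) sym \<sigma>(1) by blast
    then have "choice_eval \<sigma> (h \<circ> f) = \<zero>\<^bsub>L\<^esub>" using eval_act f(1) x by simp
    then show ?thesis using local[OF f(2)] \<sigma>(2) by metis
  qed
  have bounded: "\<exists>m. h \<circ> f \<in> L.indexed_pset ({..<m} \<times> {1..n}) (carrier L)"
    if "f \<in> carrier (aff_inf_ring K n)" for f
    using that mpoly_map_closed[OF cr, of f "UNIV \<times> {1..n}"] L.indexed_pset_bounded
    by (metis aff_inf_ring_def mpoly_ring_simps(1))
  have "f \<in> x \<longleftrightarrow> h \<circ> f \<in> inf_point L n limit_ideal" if f: "f \<in> carrier (aff_inf_ring K n)" for f
  proof
    assume fx: "f \<in> x"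
    obtain m where m: "h \<circ> f \<in> L.indexed_pset ({..<m} \<times> {1..n}) (carrier L)" using bounded[OF f] by blast
    have "iter_eventually U m (\<lambda>b. choice_eval b (h \<circ> f) = \<zero>\<^bsub>L\<^esub>) id"
      by (rule iter_eventually_inj[OF U(3) order_refl]) (auto intro: zero[OF fx m])
    then show "h \<circ> f \<in> inf_point L n limit_ideal" by (rule eventually_imp_inf_point[OF m])
  next
    assume "h \<circ> f \<in> inf_point L n limit_ideal"
    then obtain M where M: "\<And>m a. m \<ge> M \<Longrightarrow> iter_eventually U m (\<lambda>b. choice_eval b (h \<circ> f) = \<zero>\<^bsub>L\<^esub>) a"
      using inf_point_imp_eventually by blast
    obtain m\<^sub>0 where m\<^sub>0: "h \<circ> f \<in> L.indexed_pset ({..<m\<^sub>0} \<times> {1..n}) (carrier L)" using bounded[OF f] by blast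
    define m where "m = max M m\<^sub>0"
    have m: "h \<circ> f \<in> L.indexed_pset ({..<m} \<times> {1..n}) (carrier L)"
      by (rule L.indexed_pset_mono[OF _ m\<^sub>0]) (auto simp: m_def)
    have "\<exists>b. inj_on b {..<m} \<and> choice_eval b (h \<circ> f) = \<zero>\<^bsub>L\<^esub>"
    proof (rule ccontr)
      \<comment> \<open>Otherwise nonvanishing would hold for almost all choices, as they are
        injective, and would contradict the vanishing given by \<open>M\<close>.\<close>
      assume n: "\<not> ?thesis"
      have "iter_eventually U m (\<lambda>b. choice_eval b (h \<circ> f) \<noteq> \<zero>\<^bsub>L\<^esub>) id"
        by (rule iter_eventually_inj[OF U(3) order_refl]) (use n in auto)
      from iter_eventually_conj[OF this M[of m]] have "iter_eventually U m (\<lambda>b. False) id"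
        by (simp add: m_def)
      then show False using iter_eventually_False[OF U(2)] by blast
    qed
    then obtain b where b: "inj_on b {..<m}" "choice_eval b (h \<circ> f) = \<zero>\<^bsub>L\<^esub>" by blast
    obtain \<sigma> where \<sigma>: "\<sigma> \<in> Sym_inf" "\<And>i. i < m \<Longrightarrow> \<sigma> i = b i"
      using exists_Sym_inf_extension[OF b(1)] by blast
    have "choice_eval \<sigma> (h \<circ> f) = \<zero>\<^bsub>L\<^esub>" using local[OF m] \<sigma>(2) b(2) by metis
    then have \<sigma>f: "sym_act K \<sigma> f \<in> x" using eval_act[OF f] act_closed[OF f] x by simp
    \<comment> \<open>The permuted polynomial lies in \<open>x\<close>; the inverse permutation
      brings the points back to their original order. Since \<open>\<sigma>\<close> can move
      variables to later blocks, \<open>?F\<close> gets its own bound \<open>k\<close>.\<close>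
    let ?F = "sym_act K \<sigma> f"
    obtain k where k: "h \<circ> ?F \<in> L.indexed_pset ({..<k} \<times> {1..n}) (carrier L)"
      using bounded[OF act_closed[OF f]] by blast
    have bij: "bij \<sigma>" using \<sigma>(1) by (auto simp: Sym_inf_def permutes_bij)
    have "choice_eval (inv_into UNIV \<sigma>) (h \<circ> ?F) = \<zero>\<^bsub>L\<^esub>"
      using zero[OF \<sigma>f k] bij by (metis bij_imp_bij_inv bij_is_inj inj_on_subset subset_UNIV)
    moreover have "choice_eval (inv_into UNIV \<sigma>) (h \<circ> ?F) = mpoly_eval L \<xi> (h \<circ> f)"
    proof -
      have f': "f \<in> K.indexed_pset (UNIV \<times> {1..n}) (carrier K)"
        using f by (simp add: aff_inf_ring_def mpoly_ring_simps)
      show ?thesis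
        unfolding sym_act_def mpoly_map_rename[OF cr f'] choice_eval_def
        by (subst L.mpoly_eval_rename[OF mpoly_map_closed[OF cr f'] point_closed(2)])
          (simp add: o_def case_prod_beta' bij_is_inj[OF bij])
    qed
    ultimately show "f \<in> x" using f x by simp
  qed
  then have "x = proj_point K n h (inf_point L n limit_ideal)"
    unfolding proj_point_def using x by blast
  then show ?thesis using limit_ideal_prime by blast
qed

section \<open>Embedding a domain into an algebraically closed field on a given type\<close>

context domain
begin

definition fractions :: "('a \<times> 'a) set" where
  "fractions = carrier R \<times> (carrier R - {\<zero>})"

definition fraction_class :: "'a \<times> 'a \<Rightarrow> ('a \<times> 'a) set" where
  "fraction_class p = {q \<in> fractions. fst p \<otimes> snd q = fst q \<otimes> snd p}"

definition fraction_rep :: "('a \<times> 'a) set \<Rightarrow> 'a \<times> 'a" where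
  "fraction_rep u = (SOME p. p \<in> fractions \<and> fraction_class p = u)"

definition fraction_mult :: "'a \<times> 'a \<Rightarrow> 'a \<times> 'a \<Rightarrow> 'a \<times> 'a" where
  "fraction_mult p q = (fst p \<otimes> fst q, snd p \<otimes> snd q)"

definition fraction_add :: "'a \<times> 'a \<Rightarrow> 'a \<times> 'a \<Rightarrow> 'a \<times> 'a" where
  "fraction_add p q = (fst p \<otimes> snd q \<oplus> fst q \<otimes> snd p, snd p \<otimes> snd q)"

text \<open>The operations use chosen representatives of the classes;
  \<open>fraction_field_mult\<close> and \<open>fraction_field_add\<close> show that the choice does
  not affect the result.\<close>

definition fraction_field :: "('a \<times> 'a) set ring" where
  "fraction_field =
    \<lparr> carrier = fraction_class ` fractions,
      monoid.mult = (\<lambda>u v. fraction_class (fraction_mult (fraction_rep u) (fraction_rep v))),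
      one = fraction_class (\<one>, \<one>),
      ring.zero = fraction_class (\<zero>, \<one>),
      add = (\<lambda>u v. fraction_class (fraction_add (fraction_rep u) (fraction_rep v))) \<rparr>"

lemma fractionsI [intro]: "a \<in> carrier R \<Longrightarrow> b \<in> carrier R \<Longrightarrow> b \<noteq> \<zero> \<Longrightarrow> (a, b) \<in> fractions"
  by (simp add: fractions_def)

lemma fractionsD:
  "p \<in> fractions \<Longrightarrow> fst p \<in> carrier R" "p \<in> fractions \<Longrightarrow> snd p \<in> carrier R"
  "p \<in> fractions \<Longrightarrow> snd p \<noteq> \<zero>"
  by (auto simp: fractions_def)

text \<open>The equation is first proved after multiplication by \<open>snd q\<close>, which can be
  cancelled because it is nonzero in a domain.\<close>

lemma fraction_cross_trans:
  assumes "p \<in> fractions" "q \<in> fractions" "r \<in> fractions"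
    and "fst p \<otimes> snd q = fst q \<otimes> snd p" "fst q \<otimes> snd r = fst r \<otimes> snd q"
  shows "fst p \<otimes> snd r = fst r \<otimes> snd p"
proof -
  note c = fractionsD[OF assms(1)] fractionsD[OF assms(2)] fractionsD[OF assms(3)]
  have "(fst p \<otimes> snd r) \<otimes> snd q = (fst p \<otimes> snd q) \<otimes> snd r" using c by (simp add: m_ac)
  also have "\<dots> = (fst q \<otimes> snd r) \<otimes> snd p" using c assms(4) by (simp add: m_ac)
  also have "\<dots> = (fst r \<otimes> snd p) \<otimes> snd q" using c assms(5) by (simp add: m_ac)
  finally show ?thesis using c by (simp add: m_rcancel)
qed

lemma fraction_class_eq_iff:
  assumes p: "p \<in> fractions" and q: "q \<in> fractions"
  shows "fraction_class p = fraction_class q \<longleftrightarrow> fst p \<otimes> snd q = fst q \<otimes> snd p"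
proof
  assume "fraction_class p = fraction_class q"
  moreover have "q \<in> fraction_class q" using q by (simp add: fraction_class_def)
  ultimately show "fst p \<otimes> snd q = fst q \<otimes> snd p" by (auto simp: fraction_class_def)
next
  assume eq: "fst p \<otimes> snd q = fst q \<otimes> snd p"
  show "fraction_class p = fraction_class q"
    unfolding fraction_class_def
    using fraction_cross_trans[OF p q _ eq] fraction_cross_trans[OF q p _ eq[symmetric]] by blast
qed

lemma fraction_rep:
  assumes "p \<in> fractions"
  shows "fraction_rep (fraction_class p) \<in> fractions"
    and "fst (fraction_rep (fraction_class p)) \<otimes> snd p = fst p \<otimes> snd (fraction_rep (fraction_class p))"
proof -
  have "fraction_rep (fraction_class p) \<in> fractions \<and>
      fraction_class (fraction_rep (fraction_class p)) = fraction_class p"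
    unfolding fraction_rep_def by (rule someI[of _ p]) (simp add: assms)
  then show "fraction_rep (fraction_class p) \<in> fractions"
    and "fst (fraction_rep (fraction_class p)) \<otimes> snd p = fst p \<otimes> snd (fraction_rep (fraction_class p))"
    using fraction_class_eq_iff[OF _ assms] by blast+
qed

lemma fraction_ops_closed:
  assumes "p \<in> fractions" "q \<in> fractions"
  shows "fraction_mult p q \<in> fractions" "fraction_add p q \<in> fractions"
  using fractionsD[OF assms(1)] fractionsD[OF assms(2)]
  by (auto simp: fraction_mult_def fraction_add_def integral_iff intro!: fractionsI)

lemma fraction_field_simps:
  "carrier fraction_field = fraction_class ` fractions"
  "\<one>\<^bsub>fraction_field\<^esub> = fraction_class (\<one>, \<one>)"
  "\<zero>\<^bsub>fraction_field\<^esub> = fraction_class (\<zero>, \<one>)"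
  by (simp_all add: fraction_field_def)

lemma fraction_field_mult:
  assumes p: "p \<in> fractions" and q: "q \<in> fractions"
  shows "fraction_class p \<otimes>\<^bsub>fraction_field\<^esub> fraction_class q = fraction_class (fraction_mult p q)"
proof -
  let ?p = "fraction_rep (fraction_class p)" and ?q = "fraction_rep (fraction_class q)"
  note r = fraction_rep[OF p] fraction_rep[OF q]
  note c = fractionsD[OF p] fractionsD[OF q] fractionsD[OF r(1)] fractionsD[OF r(3)]
  have "(fst ?p \<otimes> fst ?q) \<otimes> (snd p \<otimes> snd q) = (fst ?p \<otimes> snd p) \<otimes> (fst ?q \<otimes> snd q)"
    using c by (simp add: m_ac)
  also have "\<dots> = (fst p \<otimes> fst q) \<otimes> (snd ?p \<otimes> snd ?q)"
    unfolding r(2,4) using c by (simp add: m_ac)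
  finally have "fraction_class (fraction_mult ?p ?q) = fraction_class (fraction_mult p q)"
    unfolding fraction_class_eq_iff[OF fraction_ops_closed(1)[OF r(1,3)] fraction_ops_closed(1)[OF p q]]
    by (simp add: fraction_mult_def)
  then show ?thesis by (simp add: fraction_field_def)
qed

lemma fraction_field_add:
  assumes p: "p \<in> fractions" and q: "q \<in> fractions"
  shows "fraction_class p \<oplus>\<^bsub>fraction_field\<^esub> fraction_class q = fraction_class (fraction_add p q)"
proof -
  let ?p = "fraction_rep (fraction_class p)" and ?q = "fraction_rep (fraction_class q)"
  note r = fraction_rep[OF p] fraction_rep[OF q]
  note c = fractionsD[OF p] fractionsD[OF q] fractionsD[OF r(1)] fractionsD[OF r(3)]
  have "(fst ?p \<otimes> snd ?q \<oplus> fst ?q \<otimes> snd ?p) \<otimes> (snd p \<otimes> snd q)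
      = (fst ?p \<otimes> snd p) \<otimes> (snd ?q \<otimes> snd q) \<oplus> (fst ?q \<otimes> snd q) \<otimes> (snd ?p \<otimes> snd p)"
    using c by (simp add: l_distr r_distr m_ac)
  also have "\<dots> = (fst p \<otimes> snd q \<oplus> fst q \<otimes> snd p) \<otimes> (snd ?p \<otimes> snd ?q)"
    unfolding r(2,4) using c by (simp add: l_distr r_distr m_ac)
  finally have "fraction_class (fraction_add ?p ?q) = fraction_class (fraction_add p q)"
    unfolding fraction_class_eq_iff[OF fraction_ops_closed(2)[OF r(1,3)] fraction_ops_closed(2)[OF p q]]
    by (simp add: fraction_add_def)
  then show ?thesis by (simp add: fraction_field_def)
qed

lemma fraction_field_field: "field fraction_field"
proof -
  note ops = fraction_field_simps fraction_field_mult fraction_field_add fraction_ops_closed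
  have c: "a \<in> carrier R \<and> b \<in> carrier R \<and> b \<noteq> \<zero>" if "(a, b) \<in> fractions" for a b
    using that by (simp add: fractions_def)
  have 01: "(\<one>, \<one>) \<in> fractions" "(\<zero>, \<one>) \<in> fractions" by auto
  have eqI: "fraction_class (a, b) = fraction_class (a', b')"
    if "(a, b) \<in> fractions" "(a', b') \<in> fractions" "a \<otimes> b' = a' \<otimes> b" for a b a' b'
    using that by (simp add: fraction_class_eq_iff)
  have cring: "cring fraction_field"
  proof (rule cringI)
    show "abelian_group fraction_field"
    proof (rule abelian_groupI, goal_cases)
      case (1 u v)
      then show ?case by (auto simp: ops)
    next
      case 2
      then show ?case using 01 by (simp add: ops)
    next
      case (3 u v w)
      then obtain a b a' b' a'' b'' where f: "(a, b) \<in> fractions" "(a', b') \<in> fractions" "(a'', b'') \<in> fractions"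
        and u: "u = fraction_class (a, b)" "v = fraction_class (a', b')" "w = fraction_class (a'', b'')"
        by (auto simp: ops)
      have "fraction_add (fraction_add (a, b) (a', b')) (a'', b'') = fraction_add (a, b) (fraction_add (a', b') (a'', b''))"
        using f[THEN c] by (simp add: fraction_add_def l_distr r_distr a_ac m_ac)
      then show ?case using f by (simp add: u ops)
    next
      case (4 u v)
      then obtain a b a' b' where f: "(a, b) \<in> fractions" "(a', b') \<in> fractions"
        and u: "u = fraction_class (a, b)" "v = fraction_class (a', b')"
        by (auto simp: ops)
      have "fraction_add (a, b) (a', b') = fraction_add (a', b') (a, b)"
        using f[THEN c] by (simp add: fraction_add_def a_comm m_comm)
      then show ?case using f by (simp add: u ops)
    next
      case (5 u)
      then obtain a b where f: "(a, b) \<in> fractions" and u: "u = fraction_class (a, b)"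
        by (auto simp: ops)
      have "fraction_add (\<zero>, \<one>) (a, b) = (a, b)"
        using f[THEN c] by (simp add: fraction_add_def)
      then show ?case using f 01 by (simp add: u ops)
    next
      case (6 u)
      then obtain a b where f: "(a, b) \<in> fractions" and u: "u = fraction_class (a, b)"
        by (auto simp: ops)
      have f': "(\<ominus> a, b) \<in> fractions" using f[THEN c] by auto
      \<comment> \<open>The sum has denominator \<open>b \<otimes> b\<close>, so it equals zero only
        as a class, not as a pair.\<close>
      have "fraction_class (fraction_add (\<ominus> a, b) (a, b)) = fraction_class (\<zero>, \<one>)"
        using f[THEN c] fraction_ops_closed(2)[OF f' f] 01
        by (subst fraction_class_eq_iff) (simp_all add: fraction_add_def l_minus l_neg)
      then show ?case using f f' by (intro bexI[of _ "fraction_class (\<ominus> a, b)"]) (simp_all add: u ops)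
    qed
  next
    show "comm_monoid fraction_field"
    proof (rule comm_monoidI, goal_cases)
      case (1 u v)
      then show ?case by (auto simp: ops)
    next
      case 2
      then show ?case using 01 by (simp add: ops)
    next
      case (3 u v w)
      then obtain a b a' b' a'' b'' where f: "(a, b) \<in> fractions" "(a', b') \<in> fractions" "(a'', b'') \<in> fractions"
        and u: "u = fraction_class (a, b)" "v = fraction_class (a', b')" "w = fraction_class (a'', b'')"
        by (auto simp: ops)
      have "fraction_mult (fraction_mult (a, b) (a', b')) (a'', b'') = fraction_mult (a, b) (fraction_mult (a', b') (a'', b''))"
        using f[THEN c] by (simp add: fraction_mult_def m_ac)
      then show ?case using f by (simp add: u ops)
    next
      case (4 u)
      then obtain a b where f: "(a, b) \<in> fractions" and u: "u = fraction_class (a, b)"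
        by (auto simp: ops)
      have "fraction_mult (\<one>, \<one>) (a, b) = (a, b)"
        using f[THEN c] by (simp add: fraction_mult_def)
      then show ?case using f 01 by (simp add: u ops)
    next
      case (5 u v)
      then obtain a b a' b' where f: "(a, b) \<in> fractions" "(a', b') \<in> fractions"
        and u: "u = fraction_class (a, b)" "v = fraction_class (a', b')"
        by (auto simp: ops)
      have "fraction_mult (a, b) (a', b') = fraction_mult (a', b') (a, b)"
        using f[THEN c] by (simp add: fraction_mult_def m_comm)
      then show ?case using f by (simp add: u ops)
    qed
  next
    fix u v w
    assume "u \<in> carrier fraction_field" "v \<in> carrier fraction_field" "w \<in> carrier fraction_field"
    then obtain a b a' b' a'' b'' where f: "(a, b) \<in> fractions" "(a', b') \<in> fractions" "(a'', b'') \<in> fractions"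
      and u: "u = fraction_class (a, b)" "v = fraction_class (a', b')" "w = fraction_class (a'', b'')"
      by (auto simp: ops)
    let ?l = "fraction_mult (fraction_add (a, b) (a', b')) (a'', b'')"
    let ?r = "fraction_add (fraction_mult (a, b) (a'', b'')) (fraction_mult (a', b') (a'', b''))"
    have cl: "?l \<in> fractions" "?r \<in> fractions" using f by (simp_all add: ops)
    \<comment> \<open>The two pairs differ by a common factor \<open>b''\<close>, so distributivity
      also needs the passage to classes.\<close>
    have "fraction_class ?l = fraction_class ?r"
      unfolding fraction_class_eq_iff[OF cl] using f[THEN c]
      by (simp add: fraction_add_def fraction_mult_def l_distr r_distr m_ac)
    then show "(u \<oplus>\<^bsub>fraction_field\<^esub> v) \<otimes>\<^bsub>fraction_field\<^esub> w
        = u \<otimes>\<^bsub>fraction_field\<^esub> w \<oplus>\<^bsub>fraction_field\<^esub> v \<otimes>\<^bsub>fraction_field\<^esub> w"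
      using f by (simp add: u ops)
  qed
  show ?thesis
  proof (rule cring.cring_fieldI2[OF cring])
    show "\<zero>\<^bsub>fraction_field\<^esub> \<noteq> \<one>\<^bsub>fraction_field\<^esub>"
      using 01 by (simp add: ops fraction_class_eq_iff)
    fix u assume "u \<in> carrier fraction_field" and nz: "u \<noteq> \<zero>\<^bsub>fraction_field\<^esub>"
    then obtain a b where f: "(a, b) \<in> fractions" and u: "u = fraction_class (a, b)"
      by (auto simp: ops)
    have "a \<noteq> \<zero>"
    proof
      assume "a = \<zero>"
      then have "u = \<zero>\<^bsub>fraction_field\<^esub>"
        unfolding u fraction_field_simps using f f[THEN c] 01 by (intro eqI) auto
      then show False using nz by simp
    qed
    then have f': "(b, a) \<in> fractions" using f[THEN c] by auto
    have "fraction_class (fraction_mult (a, b) (b, a)) = fraction_class (\<one>, \<one>)"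
      using f[THEN c] fraction_ops_closed(1)[OF f f'] 01
      by (subst fraction_class_eq_iff) (simp_all add: fraction_mult_def m_comm)
    then show "\<exists>v \<in> carrier fraction_field. u \<otimes>\<^bsub>fraction_field\<^esub> v = \<one>\<^bsub>fraction_field\<^esub>"
      using f f' by (intro bexI[of _ "fraction_class (b, a)"]) (simp_all add: u ops)
  qed
qed

lemma fraction_embedding:
  "(\<lambda>a. fraction_class (a, \<one>)) \<in> ring_hom R fraction_field"
  "inj_on (\<lambda>a. fraction_class (a, \<one>)) (carrier R)"
proof -
  have f: "(a, \<one>) \<in> fractions" if "a \<in> carrier R" for a using that by auto
  show "(\<lambda>a. fraction_class (a, \<one>)) \<in> ring_hom R fraction_field"
    by (rule ring_hom_memI)
      (simp_all add: f fraction_field_simps fraction_field_mult fraction_field_add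
        fraction_mult_def fraction_add_def)
  show "inj_on (\<lambda>a. fraction_class (a, \<one>)) (carrier R)"
    by (rule inj_onI) (simp add: fraction_class_eq_iff f)
qed

end

section \<open>Algebraic closures on a prescribed type\<close>

text \<open>A polynomial over the image is pulled back along the inverse of \<open>g\<close>, and
  \<open>g\<close> carries a root in \<open>M\<close> to a root of the original.\<close>

lemma algebraically_closed_image:
  assumes "algebraically_closed M" and g: "inj_on g (carrier M)"
  shows "algebraically_closed (image_ring g M)"
proof -
  interpret M: algebraically_closed M by fact
  let ?L = "image_ring g M" and ?g' = "inv_into (carrier M) g"
  have fL: "field ?L" by (rule M.inj_imp_image_ring_is_field[OF g])
  interpret L: field ?L by (rule fL)
  have iso: "g \<in> ring_iso M ?L" by (rule inj_imp_image_ring_iso[OF g])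
  then have iso': "?g' \<in> ring_iso ?L M" by (rule ring_iso_set_sym[OF M.ring_axioms])
  then have hom': "?g' \<in> ring_hom ?L M" by (simp add: ring_iso_def)
  interpret h: ring_hom_ring ?L M ?g'
    by (rule ring_hom_ringI2[OF L.ring_axioms M.ring_axioms hom'])
  have inj': "inj_on ?g' (carrier ?L)" using iso' by (simp add: ring_iso_def bij_betw_def)
  show ?thesis
  proof (rule L.algebraically_closedI)
    fix p assume p: "p \<in> carrier (poly_ring ?L)" and deg: "length p - 1 > 1"
    have p': "map ?g' p \<in> carrier (poly_ring M)"
      by (rule polynomial_hom[OF hom' fL M.field_axioms p])
    have "M.splitted (map ?g' p)" by (rule M.roots_over_carrier[OF p'])
    \<comment> \<open>Splitting means that there are \<open>length p - 1\<close> roots with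
      multiplicity, a positive number here.\<close>
    then have "M.roots (map ?g' p) \<noteq> {#}" using deg by (auto simp: M.splitted_def)
    then obtain a where "a \<in># M.roots (map ?g' p)" by blast
    then have a: "a \<in> carrier M" "M.eval (map ?g' p) a = \<zero>\<^bsub>M\<^esub>"
      using M.roots_mem_iff_is_root[OF p'] by (auto simp: M.is_root_def)
    define b where "b = g a"
    have b: "b \<in> carrier ?L" "?g' b = a" using a g by (simp_all add: b_def image_ring_carrier)
    have ev: "L.eval p b \<in> carrier ?L"
      using p b(1) by (intro L.eval_in_carrier) (auto simp: univ_poly_carrier[symmetric] polynomial_def)
    have "?g' (L.eval p b) = M.eval (map ?g' p) (?g' b)"
      using h.eval_hom[OF L.carrier_is_subring b(1) p] by simp
    then have "?g' (L.eval p b) = ?g' \<zero>\<^bsub>?L\<^esub>" using a b h.hom_zero by simp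
    then have "L.eval p b = \<zero>\<^bsub>?L\<^esub>" using inj' ev by (meson L.zero_closed inj_onD)
    then show "\<exists>b \<in> carrier ?L. L.eval p b = \<zero>\<^bsub>?L\<^esub>" using b by blast
  qed
qed

text \<open>Lists of a fixed length are bounded by repeated products with an infinite bound, and
  there are only countably many lengths.\<close>

lemma card_of_lists_ordLeq:
  assumes "infinite B" "|K| \<le>o |B|" shows "|lists K| \<le>o |B|"
proof -
  have len: "|{xs \<in> lists K. length xs = l}| \<le>o |B|" for l
  proof (induction l)
    case 0
    have "{xs \<in> lists K. length xs = 0} = {[]}" by auto
    then have "finite {xs \<in> lists K. length xs = 0}" by simp
    then show ?case by (rule ordLess_imp_ordLeq[OF finite_ordLess_infinite2]) (rule assms(1))
  next
    case (Suc l)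
    have eq: "{xs \<in> lists K. length xs = Suc l} = (\<lambda>(x, xs). x # xs) ` (K \<times> {xs \<in> lists K. length xs = l})"
      by (auto simp: image_iff length_Suc_conv)
    have "|K \<times> {xs \<in> lists K. length xs = l}| \<le>o |B|"
      by (rule card_of_Sigma_ordLeq_infinite[OF assms]) (simp add: Suc)
    then show ?case unfolding eq by (rule ordLeq_transitive[OF card_of_image])
  qed
  have "lists K = (\<Union>l. {xs \<in> lists K. length xs = l})" by auto
  moreover have "|\<Union>l. {xs \<in> lists K. length xs = l}| \<le>o |B|"
    by (rule card_of_UNION_ordLeq_infinite[OF assms(1)])
      (use assms(1) len in \<open>auto simp: infinite_iff_card_of_nat\<close>)
  ultimately show ?thesis by simp
qed

text \<open>Every element is a root of a nonzero polynomial over \<open>K\<close>. Such polynomials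
  are lists over \<open>K\<close>, and each has finitely many roots.\<close>

lemma card_of_algebraic_closure:
  assumes "algebraic_closure L K" "infinite B" "|K| \<le>o |B|"
  shows "|carrier L| \<le>o |B|"
proof -
  interpret algebraic_closure L K by fact
  let ?P = "carrier (univ_poly L K)"
  have sub: "subring K L" by (rule subfieldE(1)[OF subfield_axioms])
  have "carrier L \<subseteq> (\<Union>p \<in> ?P. {x. is_root p x})"
  proof
    fix x assume x: "x \<in> carrier L"
    from algebraicE[OF sub x algebraic_extension[OF x]]
    obtain p where "p \<in> ?P" "p \<noteq> []" "eval p x = \<zero>\<^bsub>L\<^esub>" .
    then show "x \<in> (\<Union>p \<in> ?P. {x. is_root p x})" using x by (auto simp: is_root_def)
  qed
  moreover have "|\<Union>p \<in> ?P. {x. is_root p x}| \<le>o |B|"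
  proof (rule card_of_UNION_ordLeq_infinite[OF assms(2)])
    have "?P \<subseteq> lists K"
      by (auto simp: univ_poly_carrier[symmetric] polynomial_def)
    then show "|?P| \<le>o |B|"
      using card_of_lists_ordLeq[OF assms(2,3)] by (meson card_of_mono1 ordLeq_transitive)
    show "\<forall>p \<in> ?P. |{x. is_root p x}| \<le>o |B|"
    proof
      fix p assume "p \<in> ?P"
      then have "p \<in> carrier (poly_ring L)" by (rule carrier_polynomial_shell[OF sub])
      then have "finite {x. is_root p x}" by (rule finite_number_of_roots)
      then show "|{x. is_root p x}| \<le>o |B|"
        by (rule ordLess_imp_ordLeq[OF finite_ordLess_infinite2]) (rule assms(2))
    qed
  qed
  ultimately show ?thesis by (meson card_of_mono1 ordLeq_transitive)
qed

text \<open>The algebraic closure of the fraction field is no larger than the given type, so an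
  injection \<open>g\<close> of its carrier exists and the ring structure is transported along
  it.\<close>

lemma domain_embeds_in_algebraically_closed:
  assumes "domain D" "infinite (UNIV :: 'b set)" "|carrier D| \<le>o |UNIV :: 'b set|"
  obtains L :: "'b ring" and \<phi> where
    "algebraically_closed L" "\<phi> \<in> ring_hom D L" "inj_on \<phi> (carrier D)"
proof -
  interpret D: domain D by fact
  interpret F: field D.fraction_field by (rule D.fraction_field_field)
  have "|carrier D \<times> carrier D| \<le>o |UNIV :: 'b set|"
    by (rule card_of_Sigma_ordLeq_infinite[OF assms(2,3)]) (simp add: assms(3))
  moreover have "D.fractions \<subseteq> carrier D \<times> carrier D" by (auto simp: D.fractions_def)
  ultimately have "|D.fractions| \<le>o |UNIV :: 'b set|" by (meson card_of_mono1 ordLeq_transitive)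
  then have F_card: "|carrier D.fraction_field| \<le>o |UNIV :: 'b set|"
    unfolding D.fraction_field_simps by (rule ordLeq_transitive[OF card_of_image])
  obtain M :: "((('a \<times> 'a) set list \<times> nat) multiset \<Rightarrow> ('a \<times> 'a) set) ring"
    where M: "algebraic_closure M (F.indexed_const ` carrier D.fraction_field)"
      and c: "F.indexed_const \<in> ring_hom D.fraction_field M"
    using F.exists_closure by blast
  interpret M: algebraic_closure M "F.indexed_const ` carrier D.fraction_field" by (rule M)
  have "|F.indexed_const ` carrier D.fraction_field :: ((('a \<times> 'a) set list \<times> nat) multiset \<Rightarrow> ('a \<times> 'a) set) set|
      \<le>o |UNIV :: 'b set|"
    using card_of_image F_card by (rule ordLeq_transitive)
  then have "|carrier M| \<le>o |UNIV :: 'b set|" by (rule card_of_algebraic_closure[OF M assms(2)])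
  then obtain g :: "_ \<Rightarrow> 'b" where g: "inj_on g (carrier M)"
    unfolding card_of_ordLeq[symmetric] by blast
  define \<phi> where "\<phi> = g \<circ> (F.indexed_const \<circ> (\<lambda>a. D.fraction_class (a, \<one>\<^bsub>D\<^esub>)))"
  have hom: "F.indexed_const \<circ> (\<lambda>a. D.fraction_class (a, \<one>\<^bsub>D\<^esub>)) \<in> ring_hom D M"
    by (rule ring_hom_trans[OF D.fraction_embedding(1) c])
  have g_hom: "g \<in> ring_hom M (image_ring g M)"
    using inj_imp_image_ring_iso[OF g] by (simp add: ring_iso_def)
  show thesis
  proof (rule that)
    show "algebraically_closed (image_ring g M)"
      by (rule algebraically_closed_image[OF M.algebraically_closed_axioms g])
    show "\<phi> \<in> ring_hom D (image_ring g M)"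
      unfolding \<phi>_def by (rule ring_hom_trans[OF hom g_hom])
    \<comment> \<open>A constant is recovered as the coefficient of the empty monomial.\<close>
    have "inj_on (F.indexed_const :: _ \<Rightarrow> ((('a \<times> 'a) set list \<times> nat) multiset \<Rightarrow> _)) UNIV"
      by (rule inj_onI) (metis F.indexed_const_def)
    then show "inj_on \<phi> (carrier D)"
      unfolding \<phi>_def using ring_hom_memE(1)[OF hom]
      by (intro comp_inj_on D.fraction_embedding(2)) (auto intro: inj_on_subset g)
  qed
qed

section \<open>The generic point\<close>

lemma countable_multiset: "countable (UNIV :: 'v :: countable multiset set)"
proof -
  have "UNIV = range (mset :: 'v list \<Rightarrow> _)" by (metis surj_def ex_mset)
  then show ?thesis by (metis countableI_type countable_image)
qed

theorem theorem3p12: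
  fixes n :: nat
    and x :: "((nat \<times> nat) multiset \<Rightarrow> 'k :: alg_closed_field) set"
  assumes "uncountable (UNIV :: 'k set)"
    and "n \<ge> 1"
    and "primeideal x (aff_inf_ring ring_of_type_algebra n)"
    and "\<forall>\<sigma> \<in> Sym_inf. sym_act ring_of_type_algebra \<sigma> ` x = x"
  shows "\<exists>(L :: (nat \<Rightarrow> 'k) ring) h y.
    algebraically_closed L \<and> h \<in> ring_hom ring_of_type_algebra L \<and>
    primeideal y (aff_ring L n) \<and>
    x = proj_point ring_of_type_algebra n h (inf_point L n y)"
proof -
  let ?K = "ring_of_type_algebra :: 'k ring" and ?I = "(UNIV :: nat set) \<times> {1..n}"
  let ?R = "aff_inf_ring ?K n" and ?T = "UNIV :: (nat \<Rightarrow> 'k) set"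
  interpret K: cring ?K by (rule cring_from_type_algebra)
  interpret x: primeideal x ?R by (rule assms(3))
  interpret D: domain "?R Quot x" by (rule x.quotient_is_domain)
  have inf: "infinite ?T"
  proof
    assume "finite ?T"
    then have "finite (range (\<lambda>(i :: nat) j. if i = j then 1 else 0 :: 'k))" by (rule rev_finite_subset) simp
    moreover have "inj (\<lambda>(i :: nat) j. if i = j then 1 else 0 :: 'k)"
      by (rule injI) (metis zero_neq_one)
    ultimately show False using finite_imageD by blast
  qed
  \<comment> \<open>There are only countably many monomials, so enumerating them turns a polynomial
    into a function on \<open>nat\<close> without loss.\<close>
  have "inj (\<lambda>f :: (nat \<times> nat) multiset \<Rightarrow> 'k. f \<circ> from_nat_into UNIV)"
    by (rule injI) (metis (no_types, lifting) UNIV_I comp_apply countable_multiset ext from_nat_into_surj)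
  then have "|UNIV :: ((nat \<times> nat) multiset \<Rightarrow> 'k) set| \<le>o |?T|"
    unfolding card_of_ordLeq[symmetric] by blast
  then have R_card: "|carrier ?R| \<le>o |?T|" using card_of_mono1[OF subset_UNIV] ordLeq_transitive by blast
  have "carrier (?R Quot x) = (\<lambda>f. x +>\<^bsub>?R\<^esub> f) ` carrier ?R"
    by (auto simp: FactRing_def A_RCOSETS_def')
  then have "|carrier (?R Quot x)| \<le>o |?T|"
    using ordLeq_transitive[OF card_of_image R_card] by simp
  then obtain L :: "(nat \<Rightarrow> 'k) ring" and \<psi> where L: "algebraically_closed L"
    and \<psi>: "\<psi> \<in> ring_hom (?R Quot x) L" and inj: "inj_on \<psi> (carrier (?R Quot x))"
    using domain_embeds_in_algebraically_closed[OF x.quotient_is_domain inf] by blast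
  interpret L: algebraically_closed L by (rule L)
  \<comment> \<open>\<open>\<phi>\<close> is the residue map at \<open>x\<close> followed by the
    embedding of the residue domain; \<open>h\<close> will be its restriction to constants and
    \<open>\<xi>\<close> its values on the variables.\<close>
  define \<phi> where "\<phi> = \<psi> \<circ> (+>\<^bsub>?R\<^esub>) x"
  have \<phi>: "\<phi> \<in> ring_hom ?R L" unfolding \<phi>_def by (rule ring_hom_trans[OF x.rcos_ring_hom \<psi>])
  define h where "h = \<phi> \<circ> K.indexed_const"
  have h: "h \<in> ring_hom ?K L"
    unfolding h_def by (rule ring_hom_trans[OF K.indexed_const_hom \<phi>[unfolded aff_inf_ring_def]])
  define \<xi> where "\<xi> v = (if v \<in> ?I then \<phi> (K.indexed_var v) else \<zero>\<^bsub>L\<^esub>)" for v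
  have "\<phi> (K.indexed_var v) \<in> carrier L" if "v \<in> ?I" for v
    using that ring_hom_memE(1)[OF \<phi>]
    by (auto simp: K.indexed_var_def aff_inf_ring_def mpoly_ring_simps intro!: K.indexed_pset.intros)
  then have \<xi>: "\<xi> \<in> UNIV \<rightarrow> carrier L" by (auto simp: \<xi>_def)
  \<comment> \<open>Injectivity of \<open>\<psi>\<close> makes the kernel exactly \<open>x\<close>.
    As \<open>\<phi>\<close> is evaluation at \<open>\<xi>\<close>, the ideal \<open>x\<close> is
    then the vanishing ideal of \<open>\<xi>\<close> over the base field.\<close>
  have "\<phi> f = \<zero>\<^bsub>L\<^esub> \<longleftrightarrow> f \<in> x" if f: "f \<in> carrier ?R" for f
  proof -
    interpret \<psi>: ring_hom_ring "?R Quot x" L \<psi>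
      by (rule ring_hom_ringI2[OF D.ring_axioms L.ring_axioms \<psi>])
    have "x +>\<^bsub>?R\<^esub> f \<in> carrier (?R Quot x)" using ring_hom_memE(1)[OF x.rcos_ring_hom f] .
    then have "\<phi> f = \<zero>\<^bsub>L\<^esub> \<longleftrightarrow> x +>\<^bsub>?R\<^esub> f = \<zero>\<^bsub>?R Quot x\<^esub>"
      unfolding \<phi>_def comp_apply by (metis D.zero_closed \<psi>.hom_zero inj inj_onD)
    also have "\<dots> \<longleftrightarrow> f \<in> x"
      using f x.rcos_const_imp_mem by (auto simp: FactRing_def x.a_rcos_const)
    finally show ?thesis .
  qed
  moreover have "\<phi> f = mpoly_eval L \<xi> (h \<circ> f)" if "f \<in> carrier ?R" for f
    unfolding h_def \<xi>_def[abs_def]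
    using mpoly_hom_eq_eval[OF K.is_cring L.is_cring, of \<phi> ?I f] \<phi> that
    by (simp only: aff_inf_ring_def)
  ultimately have "x = {f \<in> carrier ?R. mpoly_eval L \<xi> (h \<circ> f) = \<zero>\<^bsub>L\<^esub>}"
    using x.a_subset by auto
  from exchangeable_point_projection[OF K.is_cring L.field_axioms h \<xi> this assms(4)]
  show ?thesis using L h by blast
qed

end
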